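(* Let $G$ be a connected simple infinite graph. Then the tangle space $\Theta$ of $G$ is homeomorphic to the quotient $G^\ast/{\approx_\ast}$ of the Stone–Čech remainder $G^\ast=\beta G\setminus G$ of $G$, in which each connected component of $G^\ast$ is collapsed to a single point.
   Context: 1-complex: $G=(V,E)$ also denotes its 1-complex, in which every edge $e=xy$ is a copy $[x,y]=\{x\}\sqcup\mathring e\sqcup\{y\}$ of $[0,1]$ with $\mathring e$ (the inner edge points) corresponding to $(0,1)$; the point set is $V\sqcup\bigsqcup_{e\in E}\mathring e$, inner edge points have their usual basic open neighbourhoods inside $\mathring e$, and a neighbourhood basis of a vertex $v$ consists of all unions $\bigcup_{e\in E(v)}[v,i_e)$ with $i_e\in\mathring e$ arbitrary, $E(v)$ being the set of edges incident with $v$. $\beta G$ is the Stone–Čech compactification of the 1-complex $G$, $G^\ast=\beta G\setminus G$ carries the subspace topology, and $\approx_\ast$ is the equivalence relation on $G^\ast$ whose classes are the connected components of $G^\ast$; $G^\ast/{\approx_\ast}$ carries the quotient topology. Tangles: $\mathcal X$ is the set of finite subsets of $V$, directed by inclusion. For $X\in\mathcal X$, $\mathcal C_X$ is the set of (graph) components of $G-X$ with the discrete topology; for $X\subseteq X'$ the map $\mathfrak c_{X',X}\colon\mathcal C_{X'}\to\mathcal C_X$ sends each component of $G-X'$ to the component of $G-X$ including it, and $\beta(\mathfrak c_{X',X})\colon\beta(\mathcal C_{X'})\to\beta(\mathcal C_X)$ is its continuous extension. The tangle space of $G$ is the compact Hausdorff space $\Theta=\varprojlim_{X\in\mathcal X}\beta(\mathcal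 C_X)$; its elements are called $\aleph_0$-tangles. *)

theory Defs
  imports "HOL-Analysis.Analysis"
begin

section \<open>Graphs\<close>

text \<open>A graph is given by its vertex set \<open>V\<close> and its edge set \<open>E\<close>, a set of 2-element subsets of \<open>V\<close>.\<close>

definition simple_graph :: "'a set \<Rightarrow> 'a set set \<Rightarrow> bool"
  where "simple_graph V E \<longleftrightarrow> (\<forall>e\<in>E. e \<subseteq> V \<and> card e = 2)"

definition incident :: "'a set set \<Rightarrow> 'a \<Rightarrow> 'a set set"
  where "incident E v = {e \<in> E. v \<in> e}"

text \<open>\<open>joined E U u v\<close>: there is a path from \<open>u\<close> to \<open>v\<close> in the subgraph induced on \<open>U\<close>.\<close>

definition joined :: "'a set set \<Rightarrow> 'a set \<Rightarrow> 'a \<Rightarrow> 'a \<Rightarrow> bool"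
  where "joined E U u v \<longleftrightarrow>
    u \<in> U \<and> v \<in> U \<and> (\<lambda>x y. x \<in> U \<and> y \<in> U \<and> {x, y} \<in> E)\<^sup>*\<^sup>* u v"

definition connected_graph :: "'a set \<Rightarrow> 'a set set \<Rightarrow> bool"
  where "connected_graph V E \<longleftrightarrow> V \<noteq> {} \<and> (\<forall>u\<in>V. \<forall>v\<in>V. joined E V u v)"

text \<open>The components of \<open>G - X\<close>, each identified with its vertex set.\<close>

definition graph_components :: "'a set \<Rightarrow> 'a set set \<Rightarrow> 'a set \<Rightarrow> 'a set set"
  where "graph_components V E X = (V - X) // {(u, v). joined E (V - X) u v}"

section \<open>The 1-complex of a graph\<close>

text \<open>
  Points are the vertices together with, for each edge \<open>e\<close>, the inner points \<open>Inner e t\<close>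
  with \<open>0 < t < 1\<close>.  To make \<open>e\<close> a copy of the unit interval one of its ends has to sit at 0;
  which one is an arbitrary choice, made by \<open>tail\<close>.
\<close>

datatype 'a complex_point = Vertex 'a | Inner "'a set" real

definition tail :: "'a set \<Rightarrow> 'a"
  where "tail e = (SOME x. x \<in> e)"

definition complex_points :: "'a set \<Rightarrow> 'a set set \<Rightarrow> 'a complex_point set"
  where "complex_points V E = Vertex ` V \<union> {Inner e t |e t. e \<in> E \<and> 0 < t \<and> t < 1}"

text \<open>The half-open segment \<open>[v, i)\<close> of \<open>e\<close>, where \<open>v\<close> is an end of \<open>e\<close> and \<open>i = Inner e s\<close>.\<close>

definition half_open_segment :: "'a \<Rightarrow> 'a set \<Rightarrow> real \<Rightarrow> 'a complex_point set"
  where "half_open_segment v e s =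
    insert (Vertex v) {Inner e t |t. 0 < t \<and> t < 1 \<and> (if v = tail e then t < s else s < t)}"

definition one_complex :: "'a set \<Rightarrow> 'a set set \<Rightarrow> 'a complex_point topology"
  where "one_complex V E = topology (\<lambda>U. U \<subseteq> complex_points V E \<and>
    (\<forall>e\<in>E. open {t. 0 < t \<and> t < 1 \<and> Inner e t \<in> U}) \<and>
    (\<forall>v. Vertex v \<in> U \<longrightarrow>
      (\<exists>i. (\<forall>e\<in>incident E v. 0 < i e \<and> i e < 1) \<and>
           (\<Union>e\<in>incident E v. half_open_segment v e (i e)) \<subseteq> U)))"

lemma openin_one_complex:
  "openin (one_complex V E) U \<longleftrightarrow> U \<subseteq> complex_points V E \<and>
    (\<forall>e\<in>E. open {t. 0 < t \<and> t < 1 \<and> Inner e t \<in> U}) \<and>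
    (\<forall>v. Vertex v \<in> U \<longrightarrow>
      (\<exists>i. (\<forall>e\<in>incident E v. 0 < i e \<and> i e < 1) \<and>
           (\<Union>e\<in>incident E v. half_open_segment v e (i e)) \<subseteq> U))" (is "_ \<longleftrightarrow> ?P U")
proof -
  have "istopology ?P"
    unfolding istopology_def
  proof (intro conjI allI impI)
    fix S T assume S: "?P S" and T: "?P T"
    show "S \<inter> T \<subseteq> complex_points V E" using S by blast
    show "\<forall>e\<in>E. open {t. 0 < t \<and> t < 1 \<and> Inner e t \<in> S \<inter> T}"
    proof
      fix e assume "e \<in> E"
      then have "open ({t. 0 < t \<and> t < 1 \<and> Inner e t \<in> S} \<inter> {t. 0 < t \<and> t < 1 \<and> Inner e t \<in> T})"
        using S T by (intro open_Int) auto
      moreover have "{t. 0 < t \<and> t < 1 \<and> Inner e t \<in> S} \<inter> {t. 0 < t \<and> t < 1 \<and> Inner e t \<in> T}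
        = {t. 0 < t \<and> t < 1 \<and> Inner e t \<in> S \<inter> T}" by auto
      ultimately show "open {t. 0 < t \<and> t < 1 \<and> Inner e t \<in> S \<inter> T}" by simp
    qed
    fix v assume v: "Vertex v \<in> S \<inter> T"
    obtain i where i: "\<forall>e\<in>incident E v. 0 < i e \<and> i e < 1"
      "(\<Union>e\<in>incident E v. half_open_segment v e (i e)) \<subseteq> S" using S v by blast
    obtain j where j: "\<forall>e\<in>incident E v. 0 < j e \<and> j e < 1"
      "(\<Union>e\<in>incident E v. half_open_segment v e (j e)) \<subseteq> T" using T v by blast
    define k where "k = (\<lambda>e. if v = tail e then min (i e) (j e) else max (i e) (j e))"
    have "half_open_segment v e (k e) \<subseteq> half_open_segment v e (i e) \<inter> half_open_segment v e (j e)" for e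
      by (auto simp: half_open_segment_def k_def)
    then have "(\<Union>e\<in>incident E v. half_open_segment v e (k e)) \<subseteq> S \<inter> T"
      using i(2) j(2) by blast
    moreover have "\<forall>e\<in>incident E v. 0 < k e \<and> k e < 1"
      using i(1) j(1) by (auto simp: k_def)
    ultimately show "\<exists>i. (\<forall>e\<in>incident E v. 0 < i e \<and> i e < 1) \<and>
           (\<Union>e\<in>incident E v. half_open_segment v e (i e)) \<subseteq> S \<inter> T"
      by (intro exI[of _ k] conjI)
  next
    fix K assume K: "\<forall>S\<in>K. ?P S"
    show "\<Union>K \<subseteq> complex_points V E" by (rule Union_least) (use K in simp)
    show "\<forall>e\<in>E. open {t. 0 < t \<and> t < 1 \<and> Inner e t \<in> \<Union>K}"
    proof
      fix e assume "e \<in> E"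
      then have "open (\<Union>S\<in>K. {t. 0 < t \<and> t < 1 \<and> Inner e t \<in> S})"
        using K by (intro open_UN) auto
      moreover have "(\<Union>S\<in>K. {t. 0 < t \<and> t < 1 \<and> Inner e t \<in> S})
        = {t. 0 < t \<and> t < 1 \<and> Inner e t \<in> \<Union>K}" by auto
      ultimately show "open {t. 0 < t \<and> t < 1 \<and> Inner e t \<in> \<Union>K}" by simp
    qed
    fix v assume "Vertex v \<in> \<Union>K"
    then obtain S where S: "S \<in> K" "Vertex v \<in> S" by (rule UnionE)
    with K have "?P S" by simp
    then obtain i where i: "\<forall>e\<in>incident E v. 0 < i e \<and> i e < 1"
      "(\<Union>e\<in>incident E v. half_open_segment v e (i e)) \<subseteq> S" using S(2) by blast
    have "(\<Union>e\<in>incident E v. half_open_segment v e (i e)) \<subseteq> \<Union>K"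
      using i(2) S(1) by (rule order_trans[OF _ Union_upper])
    with i(1) show "\<exists>i. (\<forall>e\<in>incident E v. 0 < i e \<and> i e < 1) \<and>
           (\<Union>e\<in>incident E v. half_open_segment v e (i e)) \<subseteq> \<Union>K"
      by (intro exI[of _ i] conjI)
  qed
  then show ?thesis
    unfolding one_complex_def by (simp add: topology_inverse')
qed

section \<open>Stone-\<open>\<C>\<close>ech compactification\<close>

text \<open>
  \<open>\<beta>X\<close> is the closure of the image of \<open>X\<close> in the cube indexed by all continuous
  functions \<open>X \<rightarrow> [0,1]\<close>, under the evaluation map.  Continuous functions are normalised to be
  \<open>undefined\<close> off \<open>topspace X\<close>, so that each occurs exactly once as an index.
\<close>

definition unit_maps :: "'a topology \<Rightarrow> ('a \<Rightarrow> real) set"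
  where "unit_maps X = {f \<in> extensional (topspace X). continuous_map X (top_of_set {0..1}) f}"

definition unit_cube :: "'a topology \<Rightarrow> (('a \<Rightarrow> real) \<Rightarrow> real) topology"
  where "unit_cube X = product_topology (\<lambda>f. top_of_set {0..1}) (unit_maps X)"

definition sc_embed :: "'a topology \<Rightarrow> 'a \<Rightarrow> ('a \<Rightarrow> real) \<Rightarrow> real"
  where "sc_embed X x = (\<lambda>f\<in>unit_maps X. f x)"

definition stone_cech :: "'a topology \<Rightarrow> (('a \<Rightarrow> real) \<Rightarrow> real) topology"
  where "stone_cech X =
    subtopology (unit_cube X) (unit_cube X closure_of (sc_embed X ` topspace X))"

definition stone_cech_remainder :: "'a topology \<Rightarrow> (('a \<Rightarrow> real) \<Rightarrow> real) topology"
  where "stone_cech_remainder X =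
    subtopology (stone_cech X) (topspace (stone_cech X) - sc_embed X ` topspace X)"

text \<open>
  The continuous extension to \<open>\<beta>X\<close> of a continuous map \<open>f\<close> from \<open>X\<close> to a compact Hausdorff
  space \<open>Y\<close>; it exists and is unique by \<open>ex1_stone_cech_extension\<close> below.
\<close>

definition stone_cech_extension ::
    "'a topology \<Rightarrow> 'b topology \<Rightarrow> ('a \<Rightarrow> 'b) \<Rightarrow> (('a \<Rightarrow> real) \<Rightarrow> real) \<Rightarrow> 'b"
  where "stone_cech_extension X Y f =
    (THE h. h \<in> extensional (topspace (stone_cech X)) \<and> continuous_map (stone_cech X) Y h \<and>
            (\<forall>x\<in>topspace X. h (sc_embed X x) = f x))"

definition stone_cech_map ::
    "'a topology \<Rightarrow> 'b topology \<Rightarrow> ('a \<Rightarrow> 'b) \<Rightarrow> (('a \<Rightarrow> real) \<Rightarrow> real) \<Rightarrow> (('b \<Rightarrow> real) \<Rightarrow> real)"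
  where "stone_cech_map X Y f = stone_cech_extension X (stone_cech Y) (sc_embed Y \<circ> f)"

lemma compact_Hausdorff_unit_cube:
  "compact_space (unit_cube X)" "Hausdorff_space (unit_cube X)"
  by (auto simp: unit_cube_def compact_space_product_topology Hausdorff_space_product_topology
      compact_space_subtopology Hausdorff_space_subtopology)

lemma compact_Hausdorff_stone_cech:
  "compact_space (stone_cech X)" "Hausdorff_space (stone_cech X)"
  by (auto simp: stone_cech_def compact_Hausdorff_unit_cube Hausdorff_space_subtopology
      compact_space_subtopology closedin_compact_space)

lemma continuous_map_sc_embed_cube: "continuous_map X (unit_cube X) (sc_embed X)"
proof -
  have "continuous_map X (top_of_set {0..1}) (\<lambda>x. sc_embed X x f)" if "f \<in> unit_maps X" for f
    using that by (simp add: sc_embed_def unit_maps_def)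
  then show ?thesis
    by (simp add: unit_cube_def continuous_map_componentwise sc_embed_def image_subset_iff)
qed

lemma sc_embed_in_cube: "sc_embed X ` topspace X \<subseteq> topspace (unit_cube X)"
  by (rule continuous_map_image_subset_topspace[OF continuous_map_sc_embed_cube])

lemma topspace_stone_cech:
  "topspace (stone_cech X) = unit_cube X closure_of (sc_embed X ` topspace X)"
  by (simp add: stone_cech_def closure_of_subset_topspace inf.absorb2)

lemma sc_embed_dense:
  "stone_cech X closure_of (sc_embed X ` topspace X) = topspace (stone_cech X)"
  by (simp add: stone_cech_def closure_of_subtopology closure_of_subset_topspace
      inf.absorb2 closure_of_subset sc_embed_in_cube)

lemma continuous_map_sc_embed: "continuous_map X (stone_cech X) (sc_embed X)"
  using closure_of_subset[OF sc_embed_in_cube[of X]]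
  by (auto simp: image_subset_iff stone_cech_def continuous_map_in_subtopology continuous_map_sc_embed_cube)

lemma embedding_map_sc_embed:
  assumes "completely_regular_space X" "Hausdorff_space X"
  shows "embedding_map X (unit_cube X) (sc_embed X)"
proof -
  have "unit_maps X =
    mspace (submetric (cfunspace X euclidean_metric) {f. f \<in> topspace X \<rightarrow> {0..1}})"
    by (auto simp: unit_maps_def continuous_map_in_subtopology image_subset_iff Pi_iff
        intro: bounded_subset[OF bounded_closed_interval[of 0 "1::real"]])
  then show ?thesis
    using completely_regular_space_cube_embedding_explicit[OF assms]
    by (simp add: unit_cube_def sc_embed_def[abs_def])
qed

lemma stone_cech_functorial:
  assumes f: "continuous_map X Y f"
  obtains F where "continuous_map (stone_cech X) (stone_cech Y) F"
    "\<And>x. x \<in> topspace X \<Longrightarrow> F (sc_embed X x) = sc_embed Y (f x)"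
proof
  define F where "F = (\<lambda>p. \<lambda>g\<in>unit_maps Y. p (restrict (g \<circ> f) (topspace X)) :: real)"
  have comp: "restrict (g \<circ> f) (topspace X) \<in> unit_maps X" if "g \<in> unit_maps Y" for g
    using continuous_map_compose[OF f] that by (auto simp: unit_maps_def)
  have cont: "continuous_map (unit_cube X) (unit_cube Y) F"
    unfolding unit_cube_def continuous_map_componentwise
    using comp by (auto simp: F_def intro: continuous_map_product_projection)
  show eq: "F (sc_embed X x) = sc_embed Y (f x)" if "x \<in> topspace X" for x
    using that comp by (auto simp: F_def sc_embed_def fun_eq_iff restrict_def)
  have "F ` (sc_embed X ` topspace X) \<subseteq> sc_embed Y ` topspace Y"
    using eq continuous_map_image_subset_topspace[OF f] by auto
  then have "F ` (unit_cube X closure_of (sc_embed X ` topspace X)) \<subseteq>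
      unit_cube Y closure_of (sc_embed Y ` topspace Y)"
    by (meson closure_of_mono cont continuous_map_image_closure_subset order_trans)
  then show "continuous_map (stone_cech X) (stone_cech Y) F"
    using cont by (auto simp: stone_cech_def continuous_map_in_subtopology
        continuous_map_from_subtopology closure_of_subset_topspace inf.absorb2)
qed

lemma homeomorphic_map_sc_embed_compact:
  assumes Y: "compact_space Y" "Hausdorff_space Y"
  shows "homeomorphic_map Y (stone_cech Y) (sc_embed Y)"
proof -
  have "completely_regular_space Y"
    using Y compact_Hausdorff_or_regular_imp_normal_space normal_imp_completely_regular_space
    by blast
  then have "embedding_map Y (unit_cube Y) (sc_embed Y)"
    using Y embedding_map_sc_embed by blast
  moreover have "compactin (unit_cube Y) (sc_embed Y ` topspace Y)"
    using Y(1) compact_space_def continuous_map_sc_embed_cube image_compactin by blast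
  then have "unit_cube Y closure_of (sc_embed Y ` topspace Y) = sc_embed Y ` topspace Y"
    by (simp add: closure_of_closedin compactin_imp_closedin compact_Hausdorff_unit_cube)
  ultimately show ?thesis
    by (simp add: embedding_map_def stone_cech_def)
qed

lemma ex1_stone_cech_extension:
  assumes Y: "compact_space Y" "Hausdorff_space Y" and f: "continuous_map X Y f"
  shows "\<exists>!h. h \<in> extensional (topspace (stone_cech X)) \<and> continuous_map (stone_cech X) Y h \<and>
            (\<forall>x\<in>topspace X. h (sc_embed X x) = f x)"
proof (rule ex_ex1I)
  obtain F where F: "continuous_map (stone_cech X) (stone_cech Y) F"
    "\<And>x. x \<in> topspace X \<Longrightarrow> F (sc_embed X x) = sc_embed Y (f x)"
    using stone_cech_functorial[OF f] by blast
  obtain r where r: "continuous_map (stone_cech Y) Y r"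
    "\<And>y. y \<in> topspace Y \<Longrightarrow> r (sc_embed Y y) = y"
    using homeomorphic_map_sc_embed_compact[OF Y]
    unfolding homeomorphic_map_maps homeomorphic_maps_def by blast
  let ?h = "restrict (r \<circ> F) (topspace (stone_cech X))"
  have "continuous_map (stone_cech X) Y ?h"
    using continuous_map_compose[OF F(1) r(1)] by simp
  moreover have "?h (sc_embed X x) = f x" if "x \<in> topspace X" for x
  proof -
    have "sc_embed X x \<in> topspace (stone_cech X)"
      using that continuous_map_image_subset_topspace[OF continuous_map_sc_embed] by (rule subsetD[rotated, OF imageI])
    moreover have "f x \<in> topspace Y"
      using that continuous_map_image_subset_topspace[OF f] by (rule subsetD[rotated, OF imageI])
    ultimately show ?thesis
      using that F(2) r(2) by simp
  qed
  ultimately show "\<exists>h. h \<in> extensional (topspace (stone_cech X)) \<and>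
      continuous_map (stone_cech X) Y h \<and> (\<forall>x\<in>topspace X. h (sc_embed X x) = f x)"
    by (intro exI[of _ ?h]) auto
next
  fix h k
  assume h: "h \<in> extensional (topspace (stone_cech X)) \<and> continuous_map (stone_cech X) Y h \<and>
      (\<forall>x\<in>topspace X. h (sc_embed X x) = f x)"
    and k: "k \<in> extensional (topspace (stone_cech X)) \<and> continuous_map (stone_cech X) Y k \<and>
      (\<forall>x\<in>topspace X. k (sc_embed X x) = f x)"
  have "h p = k p" if "p \<in> topspace (stone_cech X)" for p
  proof (rule forall_in_closure_of_eq[where f = h and g = k])
    show "p \<in> stone_cech X closure_of (sc_embed X ` topspace X)"
      using that by (simp add: sc_embed_dense)
    show "Hausdorff_space Y" "continuous_map (stone_cech X) Y h" "continuous_map (stone_cech X) Y k"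
      using h k Y by auto
    show "\<And>q. q \<in> sc_embed X ` topspace X \<Longrightarrow> h q = k q"
      using h k by auto
  qed
  then show "h = k"
    using h k by (blast intro: extensionalityI)
qed

lemma stone_cech_map:
  assumes "continuous_map X Y f"
  shows "continuous_map (stone_cech X) (stone_cech Y) (stone_cech_map X Y f)"
    and "\<And>x. x \<in> topspace X \<Longrightarrow> stone_cech_map X Y f (sc_embed X x) = sc_embed Y (f x)"
proof -
  have "continuous_map X (stone_cech Y) (sc_embed Y \<circ> f)"
    using assms continuous_map_compose continuous_map_sc_embed by blast
  note * = theI'[OF ex1_stone_cech_extension[OF compact_Hausdorff_stone_cech this],
      folded stone_cech_extension_def stone_cech_map_def]
  show "continuous_map (stone_cech X) (stone_cech Y) (stone_cech_map X Y f)"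
    using * by blast
  show "\<And>x. x \<in> topspace X \<Longrightarrow> stone_cech_map X Y f (sc_embed X x) = sc_embed Y (f x)"
    using * by simp
qed

section \<open>Quotient spaces and inverse limits\<close>

definition quotient_topology :: "'a topology \<Rightarrow> ('a \<times> 'a) set \<Rightarrow> 'a set topology"
  where "quotient_topology X R =
    topology (\<lambda>U. U \<subseteq> topspace X // R \<and> openin X {x \<in> topspace X. R `` {x} \<in> U})"

lemma openin_quotient_topology:
  "openin (quotient_topology X R) U \<longleftrightarrow>
    U \<subseteq> topspace X // R \<and> openin X {x \<in> topspace X. R `` {x} \<in> U}" (is "_ \<longleftrightarrow> ?P U")
proof -
  have "istopology ?P"
    unfolding istopology_def
  proof (intro conjI allI impI)
    fix S T assume S: "?P S" and T: "?P T"
    show "S \<inter> T \<subseteq> topspace X // R" using S by blast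
    have "{x \<in> topspace X. R `` {x} \<in> S \<inter> T} =
        {x \<in> topspace X. R `` {x} \<in> S} \<inter> {x \<in> topspace X. R `` {x} \<in> T}" by blast
    then show "openin X {x \<in> topspace X. R `` {x} \<in> S \<inter> T}"
      using S T by (simp add: openin_Int)
  next
    fix K assume K: "\<forall>S\<in>K. ?P S"
    show "\<Union>K \<subseteq> topspace X // R" using K by blast
    have "{x \<in> topspace X. R `` {x} \<in> \<Union>K} = (\<Union>S\<in>K. {x \<in> topspace X. R `` {x} \<in> S})"
      by blast
    then show "openin X {x \<in> topspace X. R `` {x} \<in> \<Union>K}"
      using K by auto
  qed
  then show ?thesis
    unfolding quotient_topology_def by (simp add: topology_inverse')
qed

lemma topspace_quotient_topology: "topspace (quotient_topology X R) = topspace X // R"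
proof
  show "topspace (quotient_topology X R) \<subseteq> topspace X // R"
    using openin_quotient_topology openin_topspace by blast
  have "{x \<in> topspace X. R `` {x} \<in> topspace X // R} = topspace X"
    by (auto intro: quotientI)
  then have "openin (quotient_topology X R) (topspace X // R)"
    by (simp add: openin_quotient_topology)
  then show "topspace X // R \<subseteq> topspace (quotient_topology X R)"
    by (rule openin_subset)
qed

lemma quotient_map_quotient_topology:
  "quotient_map X (quotient_topology X R) (\<lambda>x. R `` {x})"
  by (auto simp: quotient_map_def topspace_quotient_topology openin_quotient_topology
      quotient_def)

text \<open>
  \<open>connected_component_of\<close> relates no points outside \<open>topspace X\<close>, so this is an equivalence
  relation on \<open>topspace X\<close>.
\<close>

definition same_component :: "'a topology \<Rightarrow> ('a \<times> 'a) set"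
  where "same_component X = {(x, y). connected_component_of X x y}"

lemma quotient_same_component: "topspace X // same_component X = connected_components_of X"
  by (auto simp: quotient_def same_component_def connected_components_of_def)

text \<open>\<open>f j i\<close>, for \<open>i \<le> j\<close>, is the bonding map from \<open>S j\<close> to \<open>S i\<close>.\<close>

definition inverse_limit ::
    "'i::order set \<Rightarrow> ('i \<Rightarrow> 'b topology) \<Rightarrow> ('i \<Rightarrow> 'i \<Rightarrow> 'b \<Rightarrow> 'b) \<Rightarrow> ('i \<Rightarrow> 'b) topology"
  where "inverse_limit I S f =
    subtopology (product_topology S I) {x. \<forall>i\<in>I. \<forall>j\<in>I. i \<le> j \<longrightarrow> f j i (x j) = x i}"

section \<open>The tangle space\<close>

definition component_space :: "'a set \<Rightarrow> 'a set set \<Rightarrow> 'a set \<Rightarrow> 'a set topology"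
  where "component_space V E X = discrete_topology (graph_components V E X)"

text \<open>For \<open>X \<subseteq> X'\<close>, the map sending a component of \<open>G - X'\<close> to the component of \<open>G - X\<close> including it.\<close>

definition component_map :: "'a set \<Rightarrow> 'a set set \<Rightarrow> 'a set \<Rightarrow> 'a set \<Rightarrow> 'a set \<Rightarrow> 'a set"
  where "component_map V E X' X C' = (THE C. C \<in> graph_components V E X \<and> C' \<subseteq> C)"

definition tangle_space ::
    "'a set \<Rightarrow> 'a set set \<Rightarrow> ('a set \<Rightarrow> ('a set \<Rightarrow> real) \<Rightarrow> real) topology"
  where "tangle_space V E = inverse_limit {X. finite X \<and> X \<subseteq> V}
    (\<lambda>X. stone_cech (component_space V E X))
    (\<lambda>X' X. stone_cech_map (component_space V E X') (component_space V E X)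
      (component_map V E X' X))"

end

theory Submission
  imports Defs
begin

text \<open>
  Write \<open>K\<close> for the 1-complex of \<open>G\<close>.  Deleting a finite vertex set \<open>X\<close> from \<open>K\<close> leaves, apart from
  inner points of the finitely many edges inside \<open>X\<close>, the disjoint union of the open stars of the
  components of \<open>G - X\<close>.  A point \<open>p\<close> of the remainder \<open>\<beta>K - K\<close> is not in the compact subgraph on \<open>X\<close>,
  and so for each set \<open>\<A>\<close> of components it is in the closure of the open star of \<open>\<A>\<close> or of that of the
  complement of \<open>\<A>\<close>, but not of both.  The sets \<open>\<A>\<close> of the first kind form an ultrafilter on
  the components of \<open>G - X\<close>, that is, a point of \<open>\<beta>(C\<^sub>X)\<close>, which depends continuously on \<open>p\<close>
  (\<open>stone_cech_remainder_extension\<close>, \<open>side_map_exists\<close>).  These ultrafilters are compatible, and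
  together they make up the continuous \<open>tangle_map\<close> from the remainder to the tangle space.

  The tangle map is a quotient map.  The remainder need not be compact, as \<open>K\<close> is not locally compact
  at vertices of infinite degree.  But the limit points of the vertex set form a compact subset of
  the remainder, and the map is onto already on this subset: for a given tangle, the
  closures of the vertex sets \<open>\<Union>\<A>\<close>, with \<open>\<A>\<close> in one of its ultrafilters, have a common point by
  compactness (\<open>tangle_map_vertex_limit_points\<close>).

  The fibres of the tangle map are the components of the remainder.  Connected sets are mapped to
  single points because \<open>0/1\<close>-valued continuous functions separate the points of the tangle space.
  Conversely, let \<open>p\<close> and \<open>q\<close> be in one fibre.  Choose at each vertex \<open>v\<close> a star whose
  closure contains neither \<open>p\<close> nor \<open>q\<close>.  For finite \<open>X\<close> and \<open>\<A>\<close> in the ultrafilter at \<open>X\<close>, remove the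
  stars of the vertices in \<open>X\<close> from the open star of \<open>\<A>\<close>, and let \<open>Q\<close> be the intersection of the
  closures of these sets.  Then \<open>Q\<close> contains \<open>p\<close> and \<open>q\<close> and misses \<open>K\<close>.  It is connected: if \<open>Q\<close> is covered by
  disjoint open sets \<open>U\<close> and \<open>W\<close>, then by compactness so is one of the intersected sets.  This set is the
  closure of a union of connected pieces, one for each component in \<open>\<A>\<close>, each of which is inside \<open>U\<close> or inside \<open>W\<close>.  As \<open>\<A>\<close> is
  in the ultrafilter, so is the set of components whose pieces are inside \<open>U\<close>, or the set of those whose
  pieces are inside \<open>W\<close>; and then \<open>Q\<close> does not meet the other of the two open sets
  (\<open>tangle_map_eq_imp_connected\<close>).
\<close>

section \<open>Compactness and quotient maps\<close>

text \<open>
  Both uses of compactness have this form: with \<open>U\<close> empty it produces a remainder point in each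
  fibre of the tangle map, and with \<open>U\<close> the union of two disjoint open sets it shows that the
  fibre is connected.
\<close>

lemma compact_directed_Inter_subset:
  assumes "compact_space X" and closed: "\<And>C. C \<in> \<F> \<Longrightarrow> closedin X C" and ne: "\<F> \<noteq> {}"
    and directed: "\<And>C D. C \<in> \<F> \<Longrightarrow> D \<in> \<F> \<Longrightarrow> \<exists>B\<in>\<F>. B \<subseteq> C \<inter> D"
    and "openin X U" "\<Inter>\<F> \<subseteq> U"
  shows "\<exists>C\<in>\<F>. C \<subseteq> U"
proof (rule ccontr)
  assume neg: "\<not> (\<exists>C\<in>\<F>. C \<subseteq> U)"
  have finite_bound: "\<exists>B\<in>\<F>. B \<subseteq> \<Inter>\<G>" if "finite \<G>" "\<G> \<subseteq> \<F>" for \<G>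
    using that
  proof (induction rule: finite_induct)
    case empty
    then show ?case using ne by auto
  next
    case (insert C \<G>)
    then obtain B where B: "B \<in> \<F>" "B \<subseteq> \<Inter>\<G>" by auto
    obtain D where "D \<in> \<F>" "D \<subseteq> C \<inter> B" using directed[of C B] B(1) insert.prems by auto
    then show ?case using B(2) by (intro bexI[of _ D]) auto
  qed
  let ?\<D> = "(\<lambda>C. C - U) ` \<F>"
  have "\<Inter>?\<D> \<noteq> {}"
  proof (rule \<open>compact_space X\<close>[unfolded compact_space_fip, rule_format], intro conjI ballI allI impI)
    show "closedin X D" if "D \<in> ?\<D>" for D
      using that closed \<open>openin X U\<close> by (auto simp: closedin_diff)
    fix \<H> assume "finite \<H> \<and> \<H> \<subseteq> ?\<D>"
    then obtain \<G> where G: "\<G> \<subseteq> \<F>" "finite \<G>" "\<H> = (\<lambda>C. C - U) ` \<G>"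
      by (meson finite_subset_image)
    obtain B where "B \<in> \<F>" "B \<subseteq> \<Inter>\<G>" using finite_bound G by blast
    then have "B - U \<subseteq> \<Inter>\<H>" "B - U \<noteq> {}" using G(3) neg by auto
    then show "\<Inter>\<H> \<noteq> {}" by blast
  qed
  then show False using \<open>\<Inter>\<F> \<subseteq> U\<close> ne by auto
qed

text \<open>
  A continuous map from a compact space onto a Hausdorff space is closed, hence a quotient map.
  The remainder of a space that is not locally compact is not compact, but a compact subset on
  which the map is already onto suffices: a set whose preimage in \<open>Z\<close> is open has an open
  preimage in \<open>L\<close>.
\<close>

lemma quotient_map_if_compact_subset_onto:
  assumes q: "continuous_map Z Y q" and L: "compactin Z L" "q ` L = topspace Y"
    and Y: "Hausdorff_space Y"
  shows "quotient_map Z Y q"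
proof -
  have sub: "L \<subseteq> topspace Z" using L(1) by (rule compactin_subset_topspace)
  have "quotient_map (subtopology Z L) Y q"
  proof (rule continuous_closed_imp_quotient_map)
    show c: "continuous_map (subtopology Z L) Y q" using q by (rule continuous_map_from_subtopology)
    show "closed_map (subtopology Z L) Y q"
      using L(1) Y c by (auto intro: continuous_imp_closed_map simp: compactin_subspace)
    show "q ` topspace (subtopology Z L) = topspace Y" using L(2) sub by (simp add: inf.absorb2)
  qed
  then have L_open: "openin Y U" if "U \<subseteq> topspace Y" "openin (subtopology Z L) {x \<in> L. q x \<in> U}" for U
    using that sub by (simp add: quotient_map_def inf.absorb2)
  show ?thesis
    unfolding quotient_map_def
  proof (intro conjI allI impI iffI)
    show "q ` topspace Z = topspace Y"
      using continuous_map_image_subset_topspace[OF q] L(2) sub by blast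
    fix U assume U: "U \<subseteq> topspace Y"
    show "openin Z {x. x \<in> topspace Z \<and> q x \<in> U}" if "openin Y U"
      using openin_continuous_map_preimage[OF q that] by simp
    assume "openin Z {x. x \<in> topspace Z \<and> q x \<in> U}"
    then have "openin (subtopology Z L) ({x. x \<in> topspace Z \<and> q x \<in> U} \<inter> L)"
      by (rule openin_subtopology_Int)
    moreover have "{x. x \<in> topspace Z \<and> q x \<in> U} \<inter> L = {x \<in> L. q x \<in> U}" using sub by auto
    ultimately show "openin Y U" using L_open[OF U] by simp
  qed
qed

lemma quotient_map_imp_homeomorphic_quotient_topology:
  assumes q: "quotient_map Z Y q"
    and fibres: "\<And>x y. x \<in> topspace Z \<Longrightarrow> y \<in> topspace Z \<Longrightarrow> q x = q y \<longleftrightarrow> R `` {x} = R `` {y}"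
  shows "Y homeomorphic_space quotient_topology Z R"
proof -
  let ?r = "\<lambda>x. R `` {x}" and ?Q = "quotient_topology Z R"
  have r: "quotient_map Z ?Q ?r" by (rule quotient_map_quotient_topology)
  obtain g where g: "continuous_map Y ?Q g" "\<And>x. x \<in> topspace Z \<Longrightarrow> g (q x) = ?r x"
    using quotient_map_lift_exists[OF q quotient_imp_continuous_map[OF r]] fibres by metis
  obtain h where h: "continuous_map ?Q Y h" "\<And>x. x \<in> topspace Z \<Longrightarrow> h (?r x) = q x"
    using quotient_map_lift_exists[OF r quotient_imp_continuous_map[OF q]] fibres by metis
  have "h (g y) = y" if "y \<in> topspace Y" for y
    using that g(2) h(2) unfolding quotient_imp_surjective_map[OF q, symmetric] by auto
  moreover have "g (h z) = z" if "z \<in> topspace ?Q" for z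
    using that g(2) h(2) unfolding quotient_imp_surjective_map[OF r, symmetric] by auto
  ultimately have "homeomorphic_maps Y ?Q g h"
    using g(1) h(1) by (simp add: homeomorphic_maps_def)
  then show ?thesis by (auto simp: homeomorphic_space_def)
qed

lemma continuous_map_into_binary_imp_component_eq:
  assumes f: "continuous_map Z euclideanreal f" and binary: "f ` topspace Z \<subseteq> {0, 1}"
    and "connected_component_of Z x y"
  shows "f x = f y"
proof -
  obtain T where T: "connectedin Z T" "x \<in> T" "y \<in> T"
    using assms(3) by (auto simp: connected_component_of_def)
  then have "connected (f ` T)"
    using connectedin_continuous_map_image[OF f T(1)] by simp
  moreover have "finite (f ` T)"
    using binary connectedin_subset_topspace[OF T(1)] by (auto intro: finite_subset[of _ "{0,1}"])
  ultimately obtain a where "f ` T \<subseteq> {a}" by (auto simp: connected_finite_iff_sing)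
  then show ?thesis using T by auto
qed

lemma closure_of_meets_open:
  assumes "p \<in> X closure_of S" "openin X U" "p \<in> U"
  obtains y where "y \<in> S" "y \<in> U"
  using assms unfolding in_closure_of by blast

lemma completely_regular_spaceE:
  assumes "completely_regular_space X" "closedin X S" "x \<in> topspace X" "x \<notin> S"
  obtains f :: "'a \<Rightarrow> real" where "continuous_map X (top_of_set {0..1}) f" "f x = 0" "f ` S \<subseteq> {1}"
proof -
  have "closedin X S \<and> x \<in> topspace X - S" using assms by simp
  then show ?thesis
    using assms(1) that unfolding completely_regular_space_def by blast
qed

section \<open>Evaluating points of the compactification\<close>

lemma continuous_map_stone_cech_eval:
  assumes "f \<in> unit_maps X"
  shows "continuous_map (stone_cech X) euclideanreal (\<lambda>p. p f)"
proof -
  have "continuous_map (unit_cube X) (top_of_set {0..1}) (\<lambda>p. p f)"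
    unfolding unit_cube_def by (rule continuous_map_product_projection[OF assms])
  then show ?thesis
    unfolding stone_cech_def
    by (simp add: continuous_map_in_subtopology continuous_map_from_subtopology)
qed

lemma stone_cech_eval_bounds:
  assumes "p \<in> topspace (stone_cech X)" "f \<in> unit_maps X"
  shows "0 \<le> p f" "p f \<le> 1"
proof -
  have "p \<in> topspace (unit_cube X)"
    using assms(1) by (simp add: stone_cech_def)
  then show "0 \<le> p f" "p f \<le> 1"
    using assms(2) by (auto simp: unit_cube_def PiE_iff)
qed

lemma stone_cech_eqI:
  assumes "p \<in> topspace (stone_cech X)" "q \<in> topspace (stone_cech X)"
    and "\<And>f. f \<in> unit_maps X \<Longrightarrow> p f = q f"
  shows "p = q"
proof -
  have "p \<in> topspace (unit_cube X)" "q \<in> topspace (unit_cube X)"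
    using assms(1,2) by (simp_all add: stone_cech_def)
  then show ?thesis
    using assms(3) by (auto simp: unit_cube_def intro: PiE_ext)
qed

lemma sc_embed_apply [simp]: "f \<in> unit_maps X \<Longrightarrow> sc_embed X x f = f x"
  by (simp add: sc_embed_def)

lemma sc_embed_in_stone_cech: "x \<in> topspace X \<Longrightarrow> sc_embed X x \<in> topspace (stone_cech X)"
  by (rule subsetD[OF continuous_map_image_subset_topspace[OF continuous_map_sc_embed] imageI])

lemma unit_maps_bounds:
  assumes "f \<in> unit_maps X" "x \<in> topspace X"
  shows "0 \<le> f x" "f x \<le> 1"
proof -
  have "f x \<in> {0..1}"
    using assms by (simp add: unit_maps_def continuous_map_in_subtopology Pi_iff)
  then show "0 \<le> f x" "f x \<le> 1" by simp_all
qed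

lemma unit_maps_continuous:
  "f \<in> unit_maps X \<Longrightarrow> continuous_map X euclideanreal f"
  by (simp add: unit_maps_def continuous_map_in_subtopology)

lemma restrict_in_unit_maps:
  assumes "continuous_map X euclideanreal f" "\<And>x. x \<in> topspace X \<Longrightarrow> 0 \<le> f x \<and> f x \<le> 1"
  shows "restrict f (topspace X) \<in> unit_maps X"
proof -
  have "continuous_map X euclideanreal (restrict f (topspace X))"
    by (rule continuous_map_eq[OF assms(1)]) simp
  moreover have "restrict f (topspace X) \<in> topspace X \<rightarrow> {0..1}"
    using assms(2) by (simp add: Pi_iff)
  ultimately show ?thesis by (simp add: unit_maps_def continuous_map_in_subtopology)
qed

text \<open>
  All algebraic facts about points of \<open>\<beta>X\<close> below, such as multiplicativity
  \<open>p (f * g) = p f * p g\<close>, are equations or inequalities between continuous functions of the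
  point, so they need only be checked on a dense set.
\<close>

lemma stone_cech_closure_leI:
  assumes p: "p \<in> stone_cech X closure_of (sc_embed X ` S)"
    and F: "continuous_map (stone_cech X) euclideanreal F"
    and G: "continuous_map (stone_cech X) euclideanreal G"
    and le: "\<And>x. x \<in> S \<Longrightarrow> F (sc_embed X x) \<le> (G (sc_embed X x) :: real)"
  shows "F p \<le> G p"
proof (rule forall_in_closure_of[OF p])
  show "\<And>q. q \<in> sc_embed X ` S \<Longrightarrow> F q \<le> G q" using le by auto
  have "closedin (stone_cech X) {q \<in> topspace (stone_cech X). G q - F q \<in> {0..}}"
    using F G by (intro closedin_continuous_map_preimage[where Y = euclideanreal] continuous_intros) auto
  then show "closedin (stone_cech X) {q \<in> topspace (stone_cech X). F q \<le> G q}" by simp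
qed

lemma stone_cech_leI:
  assumes "p \<in> topspace (stone_cech X)"
    "continuous_map (stone_cech X) euclideanreal F"
    "continuous_map (stone_cech X) euclideanreal G"
    "\<And>x. x \<in> topspace X \<Longrightarrow> F (sc_embed X x) \<le> (G (sc_embed X x) :: real)"
  shows "F p \<le> G p"
  using assms(1) unfolding sc_embed_dense[symmetric]
  by (rule stone_cech_closure_leI[where F = F and G = G, OF _ assms(2,3)]) (rule assms(4))

lemma stone_cech_identity:
  assumes "p \<in> topspace (stone_cech X)"
    "continuous_map (stone_cech X) euclideanreal F"
    "continuous_map (stone_cech X) euclideanreal G"
    "\<And>x. x \<in> topspace X \<Longrightarrow> F (sc_embed X x) = (G (sc_embed X x) :: real)"
  shows "F p = G p"
proof (rule antisym)
  show "F p \<le> G p" by (rule stone_cech_leI[where F = F and G = G, OF assms(1,2,3)]) (simp add: assms(4))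
  show "G p \<le> F p" by (rule stone_cech_leI[where F = G and G = F, OF assms(1,3,2)]) (simp add: assms(4))
qed

lemma in_closure_of_superlevel:
  assumes p: "p \<in> topspace (stone_cech X)" and f: "f \<in> unit_maps X" and "r < p f"
  shows "p \<in> stone_cech X closure_of (sc_embed X ` {x \<in> topspace X. r < f x})"
  unfolding in_closure_of
proof (intro conjI allI impI)
  show "p \<in> topspace (stone_cech X)" by fact
  fix T assume T: "p \<in> T \<and> openin (stone_cech X) T"
  have dense: "p \<in> stone_cech X closure_of (sc_embed X ` topspace X)"
    using p by (simp add: sc_embed_dense)
  have "openin (stone_cech X) {q \<in> topspace (stone_cech X). q f \<in> {r<..}}"
    using continuous_map_stone_cech_eval[OF f]
    by (rule openin_continuous_map_preimage) (simp flip: open_openin)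
  then have "openin (stone_cech X) (T \<inter> {q \<in> topspace (stone_cech X). q f \<in> {r<..}})" (is "openin _ ?U")
    using T by (simp add: openin_Int)
  moreover have "p \<in> ?U" using p T \<open>r < p f\<close> by simp
  ultimately obtain y where y: "y \<in> sc_embed X ` topspace X" "y \<in> ?U"
    by (rule closure_of_meets_open[OF dense])
  then obtain x where "x \<in> topspace X" "y = sc_embed X x" by (elim imageE)
  then show "\<exists>y. y \<in> sc_embed X ` {x \<in> topspace X. r < f x} \<and> y \<in> T"
    using y f by (intro exI[of _ y]) simp
qed

lemma stone_cech_Urysohn:
  assumes p: "p \<in> topspace (stone_cech X)" and C: "compactin X C" and "p \<notin> sc_embed X ` C"
  obtains \<eta> where "\<eta> \<in> unit_maps X" "\<And>x. x \<in> C \<Longrightarrow> \<eta> x = 0" "p \<eta> = 1"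
proof -
  have CX: "C \<subseteq> topspace X" using C by (rule compactin_subset_topspace)
  have "completely_regular_space (stone_cech X)"
    using compact_Hausdorff_stone_cech compact_Hausdorff_or_regular_imp_normal_space
      normal_imp_completely_regular_space by blast
  moreover have "closedin (stone_cech X) (sc_embed X ` C)"
    using compactin_imp_closedin compact_Hausdorff_stone_cech(2)
      image_compactin[OF C continuous_map_sc_embed] by blast
  ultimately obtain h where h: "continuous_map (stone_cech X) (top_of_set {0..1}) h"
      "h p = (0::real)" "h ` (sc_embed X ` C) \<subseteq> {1}"
    using p \<open>p \<notin> _\<close> by (rule completely_regular_spaceE)
  then have hc: "continuous_map (stone_cech X) euclideanreal h"
      and hb: "\<And>q. q \<in> topspace (stone_cech X) \<Longrightarrow> 0 \<le> h q \<and> h q \<le> 1"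
    by (simp_all add: continuous_map_in_subtopology Pi_iff)
  let ?\<eta> = "restrict (\<lambda>x. 1 - h (sc_embed X x)) (topspace X)"
  have \<eta>: "?\<eta> \<in> unit_maps X"
  proof (rule restrict_in_unit_maps)
    show "continuous_map X euclideanreal (\<lambda>x. 1 - h (sc_embed X x))"
      using continuous_map_compose[OF continuous_map_sc_embed hc]
      by (intro continuous_intros) (simp add: o_def)
    show "0 \<le> 1 - h (sc_embed X x) \<and> 1 - h (sc_embed X x) \<le> 1" if "x \<in> topspace X" for x
      using hb[OF sc_embed_in_stone_cech[OF that]] by simp
  qed
  have "p ?\<eta> = 1 - h p"
  proof (rule stone_cech_identity[OF p continuous_map_stone_cech_eval[OF \<eta>]])
    show "continuous_map (stone_cech X) euclideanreal (\<lambda>q. 1 - h q)"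
      using hc by (intro continuous_intros)
    show "sc_embed X x ?\<eta> = 1 - h (sc_embed X x)" if "x \<in> topspace X" for x
      using \<eta> that by simp
  qed
  moreover have "?\<eta> x = 0" if "x \<in> C" for x using that h(3) CX by auto
  ultimately show ?thesis using that[of ?\<eta>] \<eta> h(2) by simp
qed

lemma stone_cech_map_apply:
  assumes \<kappa>: "continuous_map X Y \<kappa>" and u: "u \<in> topspace (stone_cech X)" and f: "f \<in> unit_maps Y"
  shows "stone_cech_map X Y \<kappa> u f = u (restrict (f \<circ> \<kappa>) (topspace X))"
proof -
  have \<kappa>f: "restrict (f \<circ> \<kappa>) (topspace X) \<in> unit_maps X"
    using f continuous_map_compose[OF \<kappa>, of "top_of_set {0..1}" f]
    by (auto simp: unit_maps_def intro: continuous_map_eq)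
  show ?thesis
  proof (rule stone_cech_identity[OF u _ continuous_map_stone_cech_eval[OF \<kappa>f]])
    show "continuous_map (stone_cech X) euclideanreal (\<lambda>q. stone_cech_map X Y \<kappa> q f)"
      using continuous_map_compose[OF stone_cech_map(1)[OF \<kappa>] continuous_map_stone_cech_eval[OF f]]
      by (simp add: o_def)
    show "\<And>x. x \<in> topspace X \<Longrightarrow> stone_cech_map X Y \<kappa> (sc_embed X x) f =
        sc_embed X x (restrict (f \<circ> \<kappa>) (topspace X))"
      using \<kappa>f f by (simp add: stone_cech_map(2)[OF \<kappa>])
  qed
qed


text \<open>
  The function \<open>\<eta> \<cdot> (f \<circ> c)\<close>, where \<open>c\<close> is defined on \<open>W\<close> only; it is extended by zero, which is
  continuous when \<open>\<eta>\<close> vanishes off \<open>W\<close>.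
\<close>

definition weighted_pullback ::
    "'a topology \<Rightarrow> 'a set \<Rightarrow> ('a \<Rightarrow> 'b) \<Rightarrow> ('a \<Rightarrow> real) \<Rightarrow> ('b \<Rightarrow> real) \<Rightarrow> 'a \<Rightarrow> real"
  where "weighted_pullback K W c \<eta> f =
    (\<lambda>w\<in>topspace K. if w \<in> W then \<eta> w * f (c w) else 0)"

definition vanishing_maps :: "'a topology \<Rightarrow> 'a set \<Rightarrow> ('a \<Rightarrow> real) set"
  where "vanishing_maps K W = {\<eta> \<in> unit_maps K. \<forall>x \<in> topspace K - W. \<eta> x = 0}"

text \<open>
  Continuity on \<open>W\<close> is clear.  Near a point off \<open>W\<close> the function is squeezed between \<open>0\<close> and
  \<open>\<eta>\<close>, and \<open>\<eta>\<close> tends to \<open>0\<close> there.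
\<close>

lemma weighted_pullback_in_unit_maps:
  assumes W: "openin K W" and c: "continuous_map (subtopology K W) D c"
    and \<eta>: "\<eta> \<in> vanishing_maps K W" and f: "f \<in> unit_maps D"
  shows "weighted_pullback K W c \<eta> f \<in> unit_maps K"
proof -
  have WK: "W \<subseteq> topspace K" using W by (rule openin_subset)
  have \<eta>0: "\<eta> x = 0" if "x \<in> topspace K - W" for x
    using \<eta> that by (auto simp: vanishing_maps_def)
  have \<eta>u: "\<eta> \<in> unit_maps K" using \<eta> by (simp add: vanishing_maps_def)
  let ?g = "\<lambda>w. if w \<in> W then \<eta> w * f (c w) else 0"
  have c_in: "c w \<in> topspace D" if "w \<in> W" for w
  proof -
    have "w \<in> topspace (subtopology K W)" using that WK by auto
    then show ?thesis
      using subsetD[OF continuous_map_image_subset_topspace[OF c] imageI] by blast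
  qed
  have bound: "0 \<le> ?g w \<and> ?g w \<le> \<eta> w" if "w \<in> topspace K" for w
  proof (cases "w \<in> W")
    case True
    then show ?thesis
      using unit_maps_bounds[OF \<eta>u that] unit_maps_bounds[OF f c_in[OF True]]
      by (simp add: mult_left_le)
  next
    case False
    then show ?thesis using unit_maps_bounds[OF \<eta>u that] by simp
  qed
  have on_W: "continuous_map (subtopology K W) euclideanreal (\<lambda>w. \<eta> w * f (c w))"
  proof (rule continuous_map_real_mult)
    show "continuous_map (subtopology K W) euclideanreal \<eta>"
      using unit_maps_continuous[OF \<eta>u] by (rule continuous_map_from_subtopology)
    show "continuous_map (subtopology K W) euclideanreal (\<lambda>w. f (c w))"
      using continuous_map_compose[OF c unit_maps_continuous[OF f]] by (simp add: o_def)
  qed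
  have "continuous_map K euclideanreal ?g"
    unfolding continuous_map_def
  proof (intro conjI allI impI)
    fix U :: "real set" assume "openin euclideanreal U"
    then have U: "open U" by simp
    have A: "openin K {w \<in> W. \<eta> w * f (c w) \<in> U}"
    proof -
      have "openin (subtopology K W) {w \<in> topspace (subtopology K W). \<eta> w * f (c w) \<in> U}"
        using on_W U by (intro openin_continuous_map_preimage) auto
      moreover have "{w \<in> topspace (subtopology K W). \<eta> w * f (c w) \<in> U} = {w \<in> W. \<eta> w * f (c w) \<in> U}"
        using WK by auto
      ultimately show ?thesis
        using W by (simp add: openin_open_subtopology)
    qed
    show "openin K {w \<in> topspace K. ?g w \<in> U}"
    proof (cases "0 \<in> U")
      case True
      then obtain e where e: "e > 0" "\<And>x. \<bar>x\<bar> < e \<Longrightarrow> x \<in> U"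
        using U by (metis open_real abs_minus_cancel diff_0 diff_0_right)
      have "openin K {w \<in> topspace K. \<eta> w \<in> {..<e}}"
        by (rule openin_continuous_map_preimage[OF unit_maps_continuous[OF \<eta>u]])
          (simp flip: open_openin)
      moreover have "{w \<in> topspace K. ?g w \<in> U} =
          {w \<in> W. \<eta> w * f (c w) \<in> U} \<union> {w \<in> topspace K. \<eta> w \<in> {..<e}}" (is "?L = ?A \<union> ?B")
      proof (intro equalityI subsetI)
        fix w assume w: "w \<in> ?L"
        show "w \<in> ?A \<union> ?B"
          using w \<eta>0[of w] e(1) by (cases "w \<in> W") auto
      next
        fix w assume w: "w \<in> ?A \<union> ?B"
        show "w \<in> ?L"
        proof (cases "w \<in> ?A")
          case True
          then show ?thesis using WK by auto
        next
          case False
          then have "w \<in> topspace K" "\<eta> w < e" using w by auto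
          then show ?thesis using bound[of w] e(2)[of "?g w"] by simp
        qed
      qed
      ultimately show ?thesis using A by (simp add: openin_Un)
    next
      case False
      then have "{w \<in> topspace K. ?g w \<in> U} = {w \<in> W. \<eta> w * f (c w) \<in> U}"
        using WK by (auto split: if_splits)
      then show ?thesis using A by simp
    qed
  qed simp
  moreover have "0 \<le> ?g w \<and> ?g w \<le> 1" if "w \<in> topspace K" for w
    using bound[OF that] unit_maps_bounds(2)[OF \<eta>u that] by linarith
  ultimately show ?thesis
    unfolding weighted_pullback_def by (rule restrict_in_unit_maps)
qed

text \<open>
  A point of the remainder is not in the compact image of \<open>K - W\<close>, so Urysohn's lemma separates
  the two.
\<close>

lemma vanishing_map_peak:
  assumes p: "p \<in> topspace (stone_cech_remainder K)" and "W \<subseteq> topspace K"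
    and "compactin K (topspace K - W)"
  obtains \<eta> where "\<eta> \<in> vanishing_maps K W" "p \<eta> = 1"
proof (rule stone_cech_Urysohn)
  show "p \<in> topspace (stone_cech K)" using p by (simp add: stone_cech_remainder_def)
  show "compactin K (topspace K - W)" by fact
  show "p \<notin> sc_embed K ` (topspace K - W)"
    using p by (auto simp: stone_cech_remainder_def)
qed (auto intro: that simp: vanishing_maps_def)

text \<open>
  A continuous map \<open>c\<close> that is defined on \<open>K\<close> up to a compact set extends to the remainder, with
  values in \<open>\<beta>D\<close>.  The extension is forced to satisfy
  \<open>p (\<eta> \<cdot> (f \<circ> c)) = p \<eta> \<cdot> \<phi> p f\<close> for all weights \<open>\<eta>\<close> that vanish off \<open>W\<close>, and some weight has
  \<open>p \<eta> = 1\<close>; so \<open>\<phi> p f\<close> is defined as \<open>p (\<eta> \<cdot> (f \<circ> c))\<close> for such an \<open>\<eta>\<close>.  The choice of \<open>\<eta>\<close>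
  does not matter because evaluation at \<open>p\<close> is multiplicative, and on the open set where
  \<open>q \<eta>\<close> is positive \<open>\<phi>\<close> is a quotient of continuous functions.
\<close>

lemma stone_cech_remainder_extension:
  assumes W: "openin K W" and cpt: "compactin K (topspace K - W)"
    and c: "continuous_map (subtopology K W) D c"
  obtains \<phi> where "continuous_map (stone_cech_remainder K) (stone_cech D) \<phi>"
    "\<And>p \<eta> f. p \<in> topspace (stone_cech_remainder K) \<Longrightarrow> \<eta> \<in> vanishing_maps K W \<Longrightarrow>
      f \<in> unit_maps D \<Longrightarrow> p (weighted_pullback K W c \<eta> f) = p \<eta> * \<phi> p f"
proof -
  let ?R = "stone_cech_remainder K" and ?B = "stone_cech K" and ?c = "weighted_pullback K W c"
  have WK: "W \<subseteq> topspace K" using W by (rule openin_subset)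
  have RB: "topspace ?R \<subseteq> topspace ?B" by (auto simp: stone_cech_remainder_def)
  have R_cont: "continuous_map ?R euclideanreal F" if "continuous_map ?B euclideanreal F" for F
    using that unfolding stone_cech_remainder_def by (rule continuous_map_from_subtopology)
  have unit: "\<eta> \<in> unit_maps K" if "\<eta> \<in> vanishing_maps K W" for \<eta>
    using that by (simp add: vanishing_maps_def)
  note pull = weighted_pullback_in_unit_maps[OF W c]
  have "\<forall>p\<in>topspace ?R. \<exists>\<eta>. \<eta> \<in> vanishing_maps K W \<and> p \<eta> = 1"
    using vanishing_map_peak[OF _ WK cpt] by metis
  then have "\<exists>\<eta>. \<forall>p\<in>topspace ?R. \<eta> p \<in> vanishing_maps K W \<and> p (\<eta> p) = 1"
    by (rule bchoice)
  then obtain \<eta> where \<eta>: "\<And>p. p \<in> topspace ?R \<Longrightarrow> \<eta> p \<in> vanishing_maps K W"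
      "\<And>p. p \<in> topspace ?R \<Longrightarrow> p (\<eta> p) = 1"
    by blast
  define \<phi> where "\<phi> = (\<lambda>p. \<lambda>f\<in>unit_maps D. p (?c (\<eta> p) f))"
  have exchange: "p (?c \<zeta> f) * p \<theta> = p (?c \<theta> f) * p \<zeta>"
    if "p \<in> topspace ?R" "\<zeta> \<in> vanishing_maps K W" "\<theta> \<in> vanishing_maps K W" "f \<in> unit_maps D" for p \<zeta> \<theta> f
  proof (rule stone_cech_identity[of p K "\<lambda>p. p (?c \<zeta> f) * p \<theta>" "\<lambda>p. p (?c \<theta> f) * p \<zeta>"])
    show "p \<in> topspace ?B" using that(1) RB by auto
    show "continuous_map ?B euclideanreal (\<lambda>p. p (?c \<zeta> f) * p \<theta>)"
      "continuous_map ?B euclideanreal (\<lambda>p. p (?c \<theta> f) * p \<zeta>)"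
      by (intro continuous_map_real_mult continuous_map_stone_cech_eval pull unit that)+
    fix x assume "x \<in> topspace K"
    then show "sc_embed K x (?c \<zeta> f) * sc_embed K x \<theta> = sc_embed K x (?c \<theta> f) * sc_embed K x \<zeta>"
      using that pull unit by (simp add: weighted_pullback_def)
  qed
  have formula: "p (?c \<theta> f) = p \<theta> * \<phi> p f"
    if "p \<in> topspace ?R" "\<theta> \<in> vanishing_maps K W" "f \<in> unit_maps D" for p \<theta> f
    using exchange[OF that(1) that(2) \<eta>(1)[OF that(1)] that(3)] \<eta>(2)[OF that(1)] that(3)
    by (simp add: \<phi>_def mult.commute)
  \<comment> \<open>\<open>M\<close> below is continuous on all of \<open>\<beta>K\<close>, agrees with \<open>\<phi>\<close> at \<open>p\<close>, and sends \<open>w\<close> to the point \<open>c w\<close>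
    of \<open>D\<close> wherever the weight exceeds \<open>1/2\<close>.  Since \<open>p\<close> is a limit of such \<open>w\<close>, its image is a
    limit of points of \<open>D\<close>.  The \<open>max\<close> avoids division by zero and the \<open>min\<close> keeps \<open>M\<close> in the cube.\<close>
  have in_\<beta>D: "\<phi> p \<in> topspace (stone_cech D)" if p: "p \<in> topspace ?R" for p
  proof -
    let ?\<theta> = "\<eta> p"
    let ?M = "\<lambda>q. \<lambda>f\<in>unit_maps D. min 1 (q (?c ?\<theta> f) / max (q ?\<theta>) (1/2))"
    let ?S = "{w \<in> topspace K. 1/2 < ?\<theta> w}"
    have \<theta>: "?\<theta> \<in> vanishing_maps K W" "p ?\<theta> = 1" using \<eta> p by auto
    have pB: "p \<in> topspace ?B" using p RB by auto
    have M_cont: "continuous_map ?B (unit_cube D) ?M"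
      unfolding unit_cube_def continuous_map_componentwise
    proof (intro conjI ballI)
      show "?M ` topspace ?B \<subseteq> extensional (unit_maps D)" by auto
      fix f assume f: "f \<in> unit_maps D"
      have "continuous_map ?B euclideanreal (\<lambda>q. min 1 (q (?c ?\<theta> f) / max (q ?\<theta>) (1/2)))"
        by (intro continuous_map_real_min continuous_map_real_divide continuous_map_real_max
            continuous_map_const[THEN iffD2] continuous_map_stone_cech_eval pull unit f \<theta>) auto
      moreover have "0 \<le> min 1 (q (?c ?\<theta> f) / max (q ?\<theta>) (1/2))" if "q \<in> topspace ?B" for q
        using stone_cech_eval_bounds(1)[OF that pull[OF \<theta>(1) f]] by simp
      ultimately show "continuous_map ?B (top_of_set {0..1}) (\<lambda>q. ?M q f)"
        using f by (simp add: continuous_map_in_subtopology Pi_iff)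
    qed
    have "?M p \<in> ?M ` (?B closure_of (sc_embed K ` ?S))"
      using in_closure_of_superlevel[OF pB unit[OF \<theta>(1)], of "1/2"] \<theta>(2) by (intro imageI) simp
    also have "\<dots> \<subseteq> unit_cube D closure_of (?M ` sc_embed K ` ?S)"
      by (rule continuous_map_image_closure_subset[OF M_cont])
    also have "\<dots> \<subseteq> unit_cube D closure_of (sc_embed D ` topspace D)"
    proof (intro closure_of_mono subsetI)
      fix u assume "u \<in> ?M ` sc_embed K ` ?S"
      then obtain w where w: "w \<in> topspace K" "1/2 < ?\<theta> w" and u: "u = ?M (sc_embed K w)" by auto
      have wW: "w \<in> W" using w \<theta>(1) by (force simp: vanishing_maps_def)
      then have "w \<in> topspace (subtopology K W)" using w by simp
      then have cw: "c w \<in> topspace D"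
        by (rule subsetD[OF continuous_map_image_subset_topspace[OF c] imageI])
      have "u = sc_embed D (c w)"
      proof (rule ext)
        fix f
        show "u f = sc_embed D (c w) f"
        proof (cases "f \<in> unit_maps D")
          case True
          then show ?thesis
            using w wW unit_maps_bounds[OF True cw] pull[OF \<theta>(1) True] unit[OF \<theta>(1)]
            by (simp add: u weighted_pullback_def)
        qed (simp add: u sc_embed_def)
      qed
      then show "u \<in> sc_embed D ` topspace D" using cw by simp
    qed
    also have "?M p = \<phi> p"
    proof (rule ext)
      fix f
      show "?M p f = \<phi> p f"
        using \<theta>(2) stone_cech_eval_bounds(2)[OF pB pull[OF \<theta>(1)], of f]
        by (cases "f \<in> unit_maps D") (simp_all add: \<phi>_def)
    qed
    finally show ?thesis by (simp add: topspace_stone_cech)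
  qed
  have "continuous_map ?R (stone_cech D) \<phi>"
    unfolding stone_cech_def continuous_map_in_subtopology
  proof
    show "\<phi> \<in> topspace ?R \<rightarrow> unit_cube D closure_of sc_embed D ` topspace D"
      using in_\<beta>D by (simp add: topspace_stone_cech Pi_iff)
    show "continuous_map ?R (unit_cube D) \<phi>"
      unfolding unit_cube_def continuous_map_componentwise
    proof (intro conjI ballI)
      show "\<phi> ` topspace ?R \<subseteq> extensional (unit_maps D)" by (auto simp: \<phi>_def)
      fix f assume f: "f \<in> unit_maps D"
      let ?T = "\<lambda>p. {q \<in> topspace ?R. q (\<eta> p) \<in> {0<..}}"
      have "continuous_map ?R euclideanreal (\<lambda>p. \<phi> p f)"
      proof (rule pasting_lemma[where I = "topspace ?R" and T = ?T
              and f = "\<lambda>p q. q (?c (\<eta> p) f) / q (\<eta> p)"])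
        fix p assume p: "p \<in> topspace ?R"
        note \<theta> = \<eta>(1)[OF p]
        show "openin ?R (?T p)"
          by (rule openin_continuous_map_preimage[OF R_cont[OF continuous_map_stone_cech_eval[OF unit[OF \<theta>]]]])
            (simp flip: open_openin)
        have "continuous_map (subtopology ?R (?T p)) euclideanreal (\<lambda>q. q g)" if "g \<in> unit_maps K" for g
          using R_cont[OF continuous_map_stone_cech_eval[OF that]] by (rule continuous_map_from_subtopology)
        then show "continuous_map (subtopology ?R (?T p)) euclideanreal (\<lambda>q. q (?c (\<eta> p) f) / q (\<eta> p))"
          using pull[OF \<theta> f] unit[OF \<theta>] by (intro continuous_map_real_divide) auto
        have val: "q (?c (\<eta> p) f) / q (\<eta> p) = \<phi> q f" if "q \<in> ?T p" for q
          using formula[OF _ \<theta> f, of q] that by simp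
        have "p \<in> ?T p" using p \<eta>(2)[OF p] by simp
        then show "\<exists>j. j \<in> topspace ?R \<and> p \<in> ?T j \<and> \<phi> p f = p (?c (\<eta> j) f) / p (\<eta> j)"
          using val p by (intro exI[of _ p]) simp
      next
        fix i j q assume "i \<in> topspace ?R" "j \<in> topspace ?R" "q \<in> topspace ?R \<inter> ?T i \<inter> ?T j"
        then show "q (?c (\<eta> i) f) / q (\<eta> i) = q (?c (\<eta> j) f) / q (\<eta> j)"
          using formula[OF _ \<eta>(1) f, of q i] formula[OF _ \<eta>(1) f, of q j] by simp
      qed
      moreover have "\<phi> p f \<in> {0..1}" if "p \<in> topspace ?R" for p
        using stone_cech_eval_bounds[OF in_\<beta>D[OF that] f] by simp
      ultimately show "continuous_map ?R (top_of_set {0..1}) (\<lambda>p. \<phi> p f)"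
        by (simp add: continuous_map_in_subtopology Pi_iff)
    qed
  qed
  then show ?thesis using formula by (rule that)
qed

section \<open>Compactifying a discrete space\<close>

definition indicator_map :: "'b set \<Rightarrow> 'b set \<Rightarrow> 'b \<Rightarrow> real"
  where "indicator_map D A = (\<lambda>d\<in>D. if d \<in> A then 1 else 0)"

text \<open>
  The points of \<open>\<beta>D\<close>, for discrete \<open>D\<close>, are the ultrafilters on \<open>D\<close>; the members of the
  ultrafilter \<open>u\<close> are the sets whose indicator function has value 1 at \<open>u\<close>.
\<close>

definition large_set :: "'b set \<Rightarrow> (('b \<Rightarrow> real) \<Rightarrow> real) \<Rightarrow> 'b set \<Rightarrow> bool"
  where "large_set D u A \<longleftrightarrow> A \<subseteq> D \<and> u (indicator_map D A) = 1"

lemma discrete_unit_maps: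
  "f \<in> unit_maps (discrete_topology D) \<longleftrightarrow> f \<in> extensional D \<and> (\<forall>d\<in>D. 0 \<le> f d \<and> f d \<le> 1)"
  by (auto simp: unit_maps_def Pi_iff)

lemma indicator_map_in_unit_maps: "indicator_map D A \<in> unit_maps (discrete_topology D)"
  by (auto simp: discrete_unit_maps indicator_map_def)

context
  fixes D :: "'b set" and u :: "('b \<Rightarrow> real) \<Rightarrow> real"
  assumes u: "u \<in> topspace (stone_cech (discrete_topology D))"
begin

lemma discrete_eval_cont:
  "continuous_map (stone_cech (discrete_topology D)) euclideanreal (\<lambda>p. p (indicator_map D A))"
  by (rule continuous_map_stone_cech_eval[OF indicator_map_in_unit_maps])

lemma eval_indicator_binary: "u (indicator_map D A) \<in> {0, 1}"
proof -
  have "u (indicator_map D A) * u (indicator_map D A) = u (indicator_map D A)"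
    by (rule stone_cech_identity[of u _ "\<lambda>u. u (indicator_map D A) * u (indicator_map D A)", OF u
          continuous_map_real_mult[OF discrete_eval_cont discrete_eval_cont] discrete_eval_cont])
      (simp add: indicator_map_in_unit_maps, simp add: indicator_map_def)
  then show ?thesis by auto
qed

lemma large_set_Int:
  assumes "large_set D u A" "large_set D u B"
  shows "large_set D u (A \<inter> B)"
proof -
  have "u (indicator_map D (A \<inter> B)) = u (indicator_map D A) * u (indicator_map D B)"
    by (rule stone_cech_identity[of u _ _ "\<lambda>u. u (indicator_map D A) * u (indicator_map D B)", OF u
          discrete_eval_cont continuous_map_real_mult[OF discrete_eval_cont discrete_eval_cont]])
      (simp add: indicator_map_in_unit_maps, simp add: indicator_map_def)
  then show ?thesis using assms by (auto simp: large_set_def)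
qed

lemma large_set_Un:
  assumes "large_set D u (A \<union> B)"
  shows "large_set D u A \<or> large_set D u B"
proof -
  have "u (indicator_map D (A \<union> B)) \<le> u (indicator_map D A) + u (indicator_map D B)"
    by (rule stone_cech_leI[of u _ _ "\<lambda>u. u (indicator_map D A) + u (indicator_map D B)", OF u
          discrete_eval_cont continuous_map_add[OF discrete_eval_cont discrete_eval_cont]])
      (simp add: indicator_map_in_unit_maps, simp add: indicator_map_def)
  then show ?thesis
    using assms eval_indicator_binary[of A] eval_indicator_binary[of B] by (auto simp: large_set_def)
qed

lemma large_set_carrier: "large_set D u D"
proof -
  have "u (indicator_map D D) = 1"
    by (rule stone_cech_identity[of u _ _ "\<lambda>_. 1", OF u discrete_eval_cont])
      (simp, simp add: indicator_map_in_unit_maps, simp add: indicator_map_def)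
  then show ?thesis by (simp add: large_set_def)
qed

lemma not_large_set_empty: "\<not> large_set D u {}"
proof -
  have "u (indicator_map D {}) = 0"
    by (rule stone_cech_identity[of u _ _ "\<lambda>_. 0", OF u discrete_eval_cont])
      (simp, simp add: indicator_map_in_unit_maps, simp add: indicator_map_def)
  then show ?thesis by (simp add: large_set_def)
qed

text \<open>
  Off the set \<open>A\<close> of points with \<open>\<bar>f d - u f\<bar> < e\<close> the distance is at least \<open>e\<close>, so
  \<open>(1 - indicator) * e \<le> \<bar>f - u f\<bar>\<close> holds on \<open>D\<close> and therefore at \<open>u\<close>, where the right side is 0.
\<close>

lemma large_set_near_value:
  assumes f: "f \<in> unit_maps (discrete_topology D)" and "0 < e"
  shows "large_set D u {d \<in> D. \<bar>f d - u f\<bar> < e}"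
proof -
  let ?A = "{d \<in> D. \<bar>f d - u f\<bar> < e}"
  let ?F = "\<lambda>v. (1 - v (indicator_map D ?A)) * e" and ?G = "\<lambda>v. \<bar>v f - u f\<bar>"
  have "?F u \<le> ?G u"
  proof (rule stone_cech_leI[of u _ ?F ?G, OF u])
    show "continuous_map (stone_cech (discrete_topology D)) euclideanreal ?F"
      by (intro continuous_map_real_mult continuous_map_diff discrete_eval_cont) auto
    show "continuous_map (stone_cech (discrete_topology D)) euclideanreal ?G"
      by (intro continuous_map_real_abs continuous_map_diff continuous_map_stone_cech_eval f) auto
    fix d assume "d \<in> topspace (discrete_topology D)"
    then show "?F (sc_embed (discrete_topology D) d) \<le> ?G (sc_embed (discrete_topology D) d)"
      using f by (simp add: indicator_map_in_unit_maps) (simp add: indicator_map_def)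
  qed
  then have "1 \<le> u (indicator_map D ?A)" using \<open>0 < e\<close> by (simp add: mult_le_0_iff)
  then show ?thesis
    using eval_indicator_binary[of ?A] by (auto simp: large_set_def)
qed

end

text \<open>
  An ultrafilter is a maximal filter, so inclusion of the families of large sets already forces
  equality: if \<open>u f\<close> and \<open>v f\<close> differed, the sets on which \<open>f\<close> is close to one or the other value
  would be disjoint and both large for \<open>v\<close>.
\<close>

lemma stone_cech_discrete_eqI:
  assumes u: "u \<in> topspace (stone_cech (discrete_topology D))"
    and v: "v \<in> topspace (stone_cech (discrete_topology D))"
    and uv: "\<And>A. large_set D u A \<Longrightarrow> large_set D v A"
  shows "u = v"
proof (rule stone_cech_eqI[OF u v])
  fix f assume f: "f \<in> unit_maps (discrete_topology D)"
  show "u f = v f"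
  proof (rule ccontr)
    let ?e = "\<bar>u f - v f\<bar> / 2"
    assume ne: "u f \<noteq> v f"
    then have e: "0 < ?e" by simp
    let ?A = "{d \<in> D. \<bar>f d - u f\<bar> < ?e}" and ?B = "{d \<in> D. \<bar>f d - v f\<bar> < ?e}"
    have "large_set D v ?A" using uv large_set_near_value[OF u f e] by simp
    then have "large_set D v (?A \<inter> ?B)"
      using large_set_Int[OF v] large_set_near_value[OF v f e] by simp
    moreover have "?A \<inter> ?B = {}" by (auto simp: abs_if field_simps split: if_splits)
    ultimately show False using not_large_set_empty[OF v] by simp
  qed
qed

lemma large_set_stone_cech_map:
  assumes \<kappa>: "\<And>d. d \<in> D' \<Longrightarrow> \<kappa> d \<in> D" and u: "u \<in> topspace (stone_cech (discrete_topology D'))"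
    and "A \<subseteq> D"
  shows "large_set D (stone_cech_map (discrete_topology D') (discrete_topology D) \<kappa> u) A \<longleftrightarrow>
    large_set D' u {d \<in> D'. \<kappa> d \<in> A}"
proof -
  have "continuous_map (discrete_topology D') (discrete_topology D) \<kappa>" using \<kappa> by (simp add: Pi_iff)
  then have "stone_cech_map (discrete_topology D') (discrete_topology D) \<kappa> u (indicator_map D A) =
      u (restrict (indicator_map D A \<circ> \<kappa>) (topspace (discrete_topology D')))"
    using u indicator_map_in_unit_maps by (rule stone_cech_map_apply)
  also have "restrict (indicator_map D A \<circ> \<kappa>) (topspace (discrete_topology D')) =
      indicator_map D' {d \<in> D'. \<kappa> d \<in> A}"
    using \<kappa> by (auto simp: indicator_map_def restrict_def)
  finally show ?thesis using \<open>A \<subseteq> D\<close> by (auto simp: large_set_def)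
qed


section \<open>The 1-complex as a union of closed edges\<close>

definition head :: "'a set \<Rightarrow> 'a"
  where "head e = (SOME x. x \<in> e \<and> x \<noteq> tail e)"

definition edge_path :: "'a set \<Rightarrow> real \<Rightarrow> 'a complex_point"
  where "edge_path e t =
    (if t \<le> 0 then Vertex (tail e) else if 1 \<le> t then Vertex (head e) else Inner e t)"

lemma simple_graph_ends:
  assumes "simple_graph V E" "e \<in> E"
  shows "\<And>x. x \<in> e \<longleftrightarrow> x = tail e \<or> x = head e" "tail e \<noteq> head e"
proof -
  have "card e = 2" using assms by (simp add: simple_graph_def)
  then obtain x y where xy: "e = {x, y}" "x \<noteq> y" unfolding card_2_iff by blast
  then have "x \<in> e" by simp
  then have t: "tail e \<in> e" unfolding tail_def by (rule someI)
  have "\<exists>z. z \<in> e \<and> z \<noteq> tail e"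
    using xy by (cases "tail e = x") (intro exI[of _ y], simp, intro exI[of _ x], simp)
  then have h: "head e \<in> e \<and> head e \<noteq> tail e" unfolding head_def by (rule someI_ex)
  show "tail e \<noteq> head e" using h by metis
  have "tail e = x \<or> tail e = y" "head e = x \<or> head e = y"
    using t h xy(1) by (simp_all only: insert_iff empty_iff simp_thms)
  then show "z \<in> e \<longleftrightarrow> z = tail e \<or> z = head e" for z
    using h unfolding xy(1) by (simp only: insert_iff empty_iff simp_thms) metis
qed

lemma simple_graph_edge_subset: "simple_graph V E \<Longrightarrow> e \<in> E \<Longrightarrow> e \<subseteq> V"
  by (simp add: simple_graph_def)

lemma edge_path_simps [simp]:
  "edge_path e 0 = Vertex (tail e)" "edge_path e 1 = Vertex (head e)"
  "0 < t \<Longrightarrow> t < 1 \<Longrightarrow> edge_path e t = Inner e t"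
  by (simp_all add: edge_path_def)

lemma edge_path_in_complex_points:
  assumes "simple_graph V E" "e \<in> E"
  shows "edge_path e t \<in> complex_points V E"
proof -
  have "tail e \<in> V" "head e \<in> V"
    using simple_graph_ends(1)[OF assms] simple_graph_edge_subset[OF assms] by auto
  then show ?thesis using assms(2) by (auto simp: edge_path_def complex_points_def)
qed

text \<open>
  The radii of a basic neighbourhood of a vertex may be chosen on each edge separately, with no
  uniform lower bound.  Hence the topology is the finest one for which all closed edges are
  continuous paths, and continuity can be tested edge by edge.
\<close>

lemma openin_one_complex_iff_edge_path:
  assumes G: "simple_graph V E"
  shows "openin (one_complex V E) U \<longleftrightarrow> U \<subseteq> complex_points V E \<and>
    (\<forall>e\<in>E. openin (top_of_set {0..1}) {t \<in> {0..1}. edge_path e t \<in> U})"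
proof (intro iffI conjI ballI)
  assume "openin (one_complex V E) U"
  note U = this[unfolded openin_one_complex]
  show "U \<subseteq> complex_points V E" using U by (rule conjunct1)
  have inner: "\<And>e. e \<in> E \<Longrightarrow> open {t. 0 < t \<and> t < 1 \<and> Inner e t \<in> U}"
    using U by (elim conjE) (rule bspec)
  have vertex: "\<And>v. Vertex v \<in> U \<Longrightarrow> \<exists>i. (\<forall>e\<in>incident E v. 0 < i e \<and> i e < 1) \<and>
           (\<Union>e\<in>incident E v. half_open_segment v e (i e)) \<subseteq> U"
    using U by (elim conjE) simp
  fix e assume e: "e \<in> E"
  note ends = simple_graph_ends[OF G e]
  show "openin (top_of_set {0..1}) {t \<in> {0..1}. edge_path e t \<in> U}"
    unfolding openin_euclidean_subtopology_iff
  proof (intro conjI ballI)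
    fix x assume x: "x \<in> {t \<in> {0..1}. edge_path e t \<in> U}"
    then consider "x = 0" | "x = 1" | "0 < x" "x < 1" by fastforce
    then show "\<exists>\<epsilon>>0. \<forall>x'\<in>{0..1}. dist x' x < \<epsilon> \<longrightarrow> x' \<in> {t \<in> {0..1}. edge_path e t \<in> U}"
    proof cases
      case 1
      then have "Vertex (tail e) \<in> U" using x by simp
      then obtain i where i: "\<forall>e\<in>incident E (tail e). 0 < i e \<and> i e < 1"
        "(\<Union>e'\<in>incident E (tail e). half_open_segment (tail e) e' (i e')) \<subseteq> U"
        using vertex by blast
      have inc: "e \<in> incident E (tail e)" using e ends by (auto simp: incident_def)
      then have sub: "half_open_segment (tail e) e (i e) \<subseteq> U" and pos: "0 < i e" using i by auto
      have "edge_path e x' \<in> U" if "x' \<in> {0..1}" "x' < i e" for x'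
      proof (cases "x' = 0")
        case True
        then show ?thesis using \<open>Vertex (tail e) \<in> U\<close> by simp
      next
        case False
        have "i e < 1" using i(1) inc by simp
        then have "0 < x'" "x' < 1" using that False by auto
        moreover have "Inner e x' \<in> half_open_segment (tail e) e (i e)"
          using calculation that by (auto simp: half_open_segment_def)
        ultimately show ?thesis using sub by auto
      qed
      then show ?thesis using pos 1 by (intro exI[of _ "i e"]) (auto simp: dist_real_def)
    next
      case 2
      then have "Vertex (head e) \<in> U" using x by simp
      then obtain i where i: "\<forall>e\<in>incident E (head e). 0 < i e \<and> i e < 1"
        "(\<Union>e'\<in>incident E (head e). half_open_segment (head e) e' (i e')) \<subseteq> U"
        using vertex by blast
      have inc: "e \<in> incident E (head e)" using e ends by (auto simp: incident_def)
      then have sub: "half_open_segment (head e) e (i e) \<subseteq> U" and pos: "i e < 1" using i by auto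
      have "edge_path e x' \<in> U" if "x' \<in> {0..1}" "i e < x'" for x'
      proof (cases "x' = 1")
        case True
        then show ?thesis using \<open>Vertex (head e) \<in> U\<close> by simp
      next
        case False
        have "0 < i e" using i(1) inc by simp
        then have "0 < x'" "x' < 1" using that False by auto
        moreover have "Inner e x' \<in> half_open_segment (head e) e (i e)"
          using calculation that ends by (auto simp: half_open_segment_def)
        ultimately show ?thesis using sub by auto
      qed
      then show ?thesis using pos 2 by (intro exI[of _ "1 - i e"]) (auto simp: dist_real_def)
    next
      case 3
      then have "x \<in> {t. 0 < t \<and> t < 1 \<and> Inner e t \<in> U}" using x by simp
      then obtain \<epsilon> where "\<epsilon> > 0" "ball x \<epsilon> \<subseteq> {t. 0 < t \<and> t < 1 \<and> Inner e t \<in> U}"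
        using inner[OF e] by (meson open_contains_ball)
      then show ?thesis
        by (intro exI[of _ \<epsilon>]) (force simp: ball_def dist_commute)
    qed
  qed auto
next
  assume *: "U \<subseteq> complex_points V E \<and>
    (\<forall>e\<in>E. openin (top_of_set {0..1}) {t \<in> {0..1}. edge_path e t \<in> U})"
  then have open_edge: "\<And>e. e \<in> E \<Longrightarrow> openin (top_of_set {0..1}) {t \<in> {0..1}. edge_path e t \<in> U}"
    by (elim conjE) (rule bspec)
  show "openin (one_complex V E) U"
    unfolding openin_one_complex
  proof (intro conjI ballI allI impI)
    show "U \<subseteq> complex_points V E" using * by blast
    fix e assume "e \<in> E"
    from open_edge[OF this] obtain T where T: "open T" "{t \<in> {0..1}. edge_path e t \<in> U} = {0..1} \<inter> T"
      unfolding openin_open by blast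
    have "{t. 0 < t \<and> t < 1 \<and> Inner e t \<in> U} = {0<..<1} \<inter> T"
    proof (rule set_eqI)
      fix t
      show "t \<in> {t. 0 < t \<and> t < 1 \<and> Inner e t \<in> U} \<longleftrightarrow> t \<in> {0<..<1} \<inter> T"
      proof (cases "0 < t \<and> t < 1")
        case True
        have "t \<in> {t \<in> {0..1}. edge_path e t \<in> U} \<longleftrightarrow> t \<in> {0..1} \<inter> T"
          by (simp only: T(2))
        then show ?thesis using True by simp
      next
        case False
        then show ?thesis by auto
      qed
    qed
    moreover have "open ({0<..<1} \<inter> T)" using T(1) by (intro open_Int open_greaterThanLessThan)
    ultimately show "open {t. 0 < t \<and> t < 1 \<and> Inner e t \<in> U}" by (simp only:)
  next
    fix v assume v: "Vertex v \<in> U"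
    have "\<exists>i. 0 < i \<and> i < 1 \<and> half_open_segment v e i \<subseteq> U" if e: "e \<in> incident E v" for e
    proof -
      have eE: "e \<in> E" "v \<in> e" using e by (auto simp: incident_def)
      note ends = simple_graph_ends[OF G eE(1)]
      have near: "\<exists>\<epsilon>>0. \<forall>x'\<in>{0..1}. dist x' x < \<epsilon> \<longrightarrow> edge_path e x' \<in> U"
        if "x \<in> {0..1}" "edge_path e x \<in> U" for x
        using open_edge[OF eE(1)] that unfolding openin_euclidean_subtopology_iff by blast
      show ?thesis
      proof (cases "v = tail e")
        case True
        obtain \<epsilon> where \<epsilon>: "\<epsilon> > 0" "\<And>x. x \<in> {0..1} \<Longrightarrow> dist x 0 < \<epsilon> \<Longrightarrow> edge_path e x \<in> U"
          using near[of 0] v True by auto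
        have "Inner e t \<in> U" if "0 < t" "t < 1" "t < min \<epsilon> (1/2)" for t
          using \<epsilon>(2)[of t] that by (simp add: dist_real_def)
        then have "half_open_segment v e (min \<epsilon> (1/2)) \<subseteq> U"
          using v True by (auto simp: half_open_segment_def)
        then show ?thesis using \<epsilon>(1) by (intro exI[of _ "min \<epsilon> (1/2)"]) auto
      next
        case False
        then have "v = head e" using ends eE by auto
        then obtain \<epsilon> where \<epsilon>: "\<epsilon> > 0" "\<And>x. x \<in> {0..1} \<Longrightarrow> dist x 1 < \<epsilon> \<Longrightarrow> edge_path e x \<in> U"
          using near[of 1] v by auto
        have "Inner e t \<in> U" if "0 < t" "t < 1" "max (1 - \<epsilon>) (1/2) < t" for t
          using \<epsilon>(2)[of t] that by (simp add: dist_real_def)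
        then have "half_open_segment v e (max (1 - \<epsilon>) (1/2)) \<subseteq> U"
          using v False by (auto simp: half_open_segment_def)
        then show ?thesis using \<epsilon>(1) by (intro exI[of _ "max (1 - \<epsilon>) (1/2)"]) auto
      qed
    qed
    then have "\<forall>e\<in>incident E v. \<exists>i. 0 < i \<and> i < 1 \<and> half_open_segment v e i \<subseteq> U" by blast
    then obtain i where "\<forall>e\<in>incident E v. 0 < i e \<and> i e < 1 \<and> half_open_segment v e (i e) \<subseteq> U"
      by (meson bchoice)
    then show "\<exists>i. (\<forall>e\<in>incident E v. 0 < i e \<and> i e < 1) \<and>
           (\<Union>e\<in>incident E v. half_open_segment v e (i e)) \<subseteq> U"
      by (intro exI[of _ i]) blast
  qed
qed

lemma topspace_one_complex:
  assumes "simple_graph V E"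
  shows "topspace (one_complex V E) = complex_points V E"
proof (rule antisym)
  show "topspace (one_complex V E) \<subseteq> complex_points V E"
    using openin_topspace[of "one_complex V E"] unfolding openin_one_complex by blast
  have "{t \<in> {0..1}. edge_path e t \<in> complex_points V E} = {0..1}" if "e \<in> E" for e
    using edge_path_in_complex_points[OF assms that] by auto
  then have "openin (one_complex V E) (complex_points V E)"
    unfolding openin_one_complex_iff_edge_path[OF assms] by simp
  then show "complex_points V E \<subseteq> topspace (one_complex V E)" by (rule openin_subset)
qed

lemma continuous_map_edge_path:
  assumes "simple_graph V E" "e \<in> E"
  shows "continuous_map (top_of_set {0..1}) (one_complex V E) (edge_path e)"
  using assms edge_path_in_complex_points[OF assms]
  by (auto simp: continuous_map_def topspace_one_complex openin_one_complex_iff_edge_path)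

lemma continuous_map_from_one_complex:
  assumes G: "simple_graph V E" and "f \<in> complex_points V E \<rightarrow> topspace Y"
    and edges: "\<And>e. e \<in> E \<Longrightarrow> continuous_map (top_of_set {0..1}) Y (\<lambda>t. f (edge_path e t))"
  shows "continuous_map (one_complex V E) Y f"
  unfolding continuous_map_def topspace_one_complex[OF G]
proof (intro conjI allI impI)
  fix U assume U: "openin Y U"
  show "openin (one_complex V E) {w \<in> complex_points V E. f w \<in> U}"
    unfolding openin_one_complex_iff_edge_path[OF G]
  proof (intro conjI ballI)
    fix e assume e: "e \<in> E"
    show "openin (top_of_set {0..1}) {t \<in> {0..1}. edge_path e t \<in> {w \<in> complex_points V E. f w \<in> U}}"
      using openin_continuous_map_preimage[OF edges[OF e] U] edge_path_in_complex_points[OF G e] by simp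
  qed auto
qed fact

text \<open>
  On each edge at \<open>v\<close>, the piecewise linear function that falls from 1 at \<open>v\<close> to 0 at the inner
  point \<open>i e\<close>, and 0 elsewhere.
\<close>

definition star_bump :: "'a \<Rightarrow> ('a set \<Rightarrow> real) \<Rightarrow> 'a complex_point \<Rightarrow> real"
  where "star_bump v i w = (case w of Vertex u \<Rightarrow> if u = v then 1 else 0
    | Inner e t \<Rightarrow> if v \<notin> e then 0 else if v = tail e then max 0 (1 - t / i e)
        else max 0 (1 - (1 - t) / (1 - i e)))"

definition edge_bump :: "'a set \<Rightarrow> 'a complex_point \<Rightarrow> real"
  where "edge_bump e w = (case w of Vertex u \<Rightarrow> 0 | Inner e' t \<Rightarrow> if e' = e then t * (1 - t) else 0)"

definition star :: "'a set set \<Rightarrow> 'a \<Rightarrow> ('a set \<Rightarrow> real) \<Rightarrow> 'a complex_point set"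
  where "star E v i = (\<Union>e\<in>incident E v. half_open_segment v e (i e))"

lemma edge_bump_in_unit_maps:
  assumes G: "simple_graph V E"
  shows "restrict (edge_bump e) (topspace (one_complex V E)) \<in> unit_maps (one_complex V E)"
proof (rule restrict_in_unit_maps)
  show "continuous_map (one_complex V E) euclideanreal (edge_bump e)"
  proof (rule continuous_map_from_one_complex[OF G])
    fix e' assume "e' \<in> E"
    have "continuous_map (top_of_set {0..1}) euclideanreal (\<lambda>t. if e' = e then t * (1 - t) else (0::real))"
      by (auto intro!: continuous_intros)
    then show "continuous_map (top_of_set {0..1}) euclideanreal (\<lambda>t. edge_bump e (edge_path e' t))"
      by (rule continuous_map_eq) (auto simp: edge_bump_def edge_path_def)
  qed simp
  show "0 \<le> edge_bump e w \<and> edge_bump e w \<le> 1" if "w \<in> topspace (one_complex V E)" for w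
    using that unfolding topspace_one_complex[OF G]
    by (auto simp: edge_bump_def complex_points_def mult_le_one)
qed

lemma star_bump_in_unit_maps:
  assumes G: "simple_graph V E" and i: "\<And>e. e \<in> incident E v \<Longrightarrow> 0 < i e \<and> i e < 1"
  shows "restrict (star_bump v i) (topspace (one_complex V E)) \<in> unit_maps (one_complex V E)"
proof (rule restrict_in_unit_maps)
  show "continuous_map (one_complex V E) euclideanreal (star_bump v i)"
  proof (rule continuous_map_from_one_complex[OF G])
    fix e assume e: "e \<in> E"
    note ends = simple_graph_ends[OF G e]
    let ?f = "\<lambda>t. if v \<notin> e then 0 else if v = tail e then max 0 (1 - t / i e)
        else max 0 (1 - (1 - t) / (1 - i e))"
    have "continuous_on {0..1} ?f"
    proof (cases "v \<in> e")
      case True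
      then have ie: "0 < i e" "i e < 1" using i[of e] e by (simp_all add: incident_def)
      have "continuous_on {0..1} (\<lambda>t. max 0 (1 - t / i e))"
        "continuous_on {0..1} (\<lambda>t. max 0 (1 - (1 - t) / (1 - i e)))"
        using ie by (intro continuous_intros; simp)+
      then show ?thesis using True by (cases "v = tail e") simp_all
    qed simp
    then have "continuous_map (top_of_set {0..1}) euclideanreal ?f"
      by (simp only: continuous_map_iff_continuous)
    then show "continuous_map (top_of_set {0..1}) euclideanreal (\<lambda>t. star_bump v i (edge_path e t))"
    proof (rule continuous_map_eq)
      fix t assume "t \<in> topspace (top_of_set {0..1::real})"
      then have "t \<in> {0..1}" by simp
      then consider "t = 0" | "t = 1" | "0 < t" "t < 1" by fastforce
      then show "?f t = star_bump v i (edge_path e t)"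
      proof cases
        case 1
        then show ?thesis using ends i[of e] e by (auto simp: star_bump_def incident_def)
      next
        case 2
        then show ?thesis using ends i[of e] e by (auto simp: star_bump_def incident_def max_def field_simps)
      next
        case 3
        then show ?thesis by (simp add: star_bump_def)
      qed
    qed
  qed simp
  show "0 \<le> star_bump v i w \<and> star_bump v i w \<le> 1" if "w \<in> topspace (one_complex V E)" for w
  proof (cases w)
    case (Vertex u)
    then show ?thesis by (simp add: star_bump_def)
  next
    case (Inner e t)
    then have e: "e \<in> E" "0 < t" "t < 1"
      using that unfolding topspace_one_complex[OF G] by (auto simp: complex_points_def)
    then have "0 < i e \<and> i e < 1" if "v \<in> e" using i[of e] that by (simp add: incident_def)
    then show ?thesis using e Inner by (auto simp: star_bump_def)
  qed
qed

lemma star_bump_outside_star: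
  assumes G: "simple_graph V E" and i: "\<And>e. e \<in> incident E v \<Longrightarrow> 0 < i e \<and> i e < 1"
    and w: "w \<in> complex_points V E" "w \<notin> star E v i" "w \<noteq> Vertex v"
  shows "star_bump v i w = 0"
proof (cases w)
  case (Vertex u)
  then show ?thesis using w by (simp add: star_bump_def)
next
  case (Inner e t)
  then have e: "e \<in> E" "0 < t" "t < 1" using w by (auto simp: complex_points_def)
  show ?thesis
  proof (cases "v \<in> e")
    case True
    then have inc: "e \<in> incident E v" using e by (simp add: incident_def)
    then have "Inner e t \<notin> half_open_segment v e (i e)" using w(2) Inner by (auto simp: star_def)
    then show ?thesis
      using e i[OF inc] True Inner
      by (cases "v = tail e") (auto simp: star_bump_def half_open_segment_def max_def field_simps)
  qed (simp add: Inner star_bump_def)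
qed

lemma star_bump_centre [simp]: "star_bump v i (Vertex v) = 1"
  by (simp add: star_bump_def)

text \<open>
  The 1-complex induced on \<open>U\<close> together with all inner points of edges that leave \<open>U\<close>.  For a
  component \<open>C\<close> of \<open>G - X\<close> this is a component of the 1-complex minus the points of \<open>X\<close>: the inner
  points of the edges between \<open>C\<close> and \<open>X\<close> belong to the side of \<open>C\<close>.
\<close>

definition open_star :: "'a set set \<Rightarrow> 'a set \<Rightarrow> 'a complex_point set"
  where "open_star E U = Vertex ` U \<union> {Inner e t |e t. e \<in> E \<and> e \<inter> U \<noteq> {} \<and> 0 < t \<and> t < 1}"

lemma in_open_star [simp]:
  "Vertex v \<in> open_star E U \<longleftrightarrow> v \<in> U"
  "Inner e t \<in> open_star E U \<longleftrightarrow> e \<in> E \<and> e \<inter> U \<noteq> {} \<and> 0 < t \<and> t < 1"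
  by (auto simp: open_star_def)

lemma open_star_mono:
  assumes "U \<subseteq> U'"
  shows "open_star E U \<subseteq> open_star E U'"
proof
  fix w assume "w \<in> open_star E U"
  then show "w \<in> open_star E U'" using assms by (cases w) auto
qed

lemma open_star_Union: "open_star E (\<Union>\<A>) = (\<Union>U\<in>\<A>. open_star E U)"
proof (rule set_eqI)
  fix w
  show "w \<in> open_star E (\<Union>\<A>) \<longleftrightarrow> w \<in> (\<Union>U\<in>\<A>. open_star E U)" by (cases w) auto
qed

lemma openin_open_star:
  assumes "U \<subseteq> V"
  shows "openin (one_complex V E) (open_star E U)"
  unfolding openin_one_complex
proof (intro conjI ballI allI impI)
  show "open_star E U \<subseteq> complex_points V E"
    using assms by (auto simp: open_star_def complex_points_def)
  fix e assume "e \<in> E"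
  then have "{t. 0 < t \<and> t < 1 \<and> Inner e t \<in> open_star E U} = (if e \<inter> U = {} then {} else {0<..<1})"
    by (auto simp: open_star_def)
  then show "open {t. 0 < t \<and> t < 1 \<and> Inner e t \<in> open_star E U}" by simp
next
  fix v assume "Vertex v \<in> open_star E U"
  then have "v \<in> U" by (auto simp: open_star_def)
  then show "\<exists>i. (\<forall>e\<in>incident E v. 0 < i e \<and> i e < 1) \<and>
           (\<Union>e\<in>incident E v. half_open_segment v e (i e)) \<subseteq> open_star E U"
    by (intro exI[of _ "\<lambda>_. 1/2"]) (auto simp: open_star_def incident_def half_open_segment_def)
qed

text \<open>
  What remains is the finite subgraph induced on \<open>X\<close>.
\<close>

lemma compactin_outside_open_star:
  assumes G: "simple_graph V E" and X: "finite X" "X \<subseteq> V"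
  shows "compactin (one_complex V E) (topspace (one_complex V E) - open_star E (V - X))"
proof -
  let ?K = "one_complex V E" and ?F = "{e \<in> E. e \<subseteq> X}"
  have outside: "topspace ?K - open_star E (V - X) = Vertex ` X \<union> \<Union>((\<lambda>e. edge_path e ` {0..1}) ` ?F)"
  proof (intro equalityI subsetI)
    fix w assume w: "w \<in> topspace ?K - open_star E (V - X)"
    show "w \<in> Vertex ` X \<union> \<Union>((\<lambda>e. edge_path e ` {0..1}) ` ?F)"
    proof (cases w)
      case (Vertex u)
      then show ?thesis
        using w unfolding topspace_one_complex[OF G] by (auto simp: complex_points_def open_star_def)
    next
      case (Inner e t)
      then have e: "e \<in> E" "0 < t" "t < 1"
        using w unfolding topspace_one_complex[OF G] by (auto simp: complex_points_def)
      then have "e \<subseteq> X"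
        using w Inner simple_graph_edge_subset[OF G] by (auto simp: open_star_def)
      then have "e \<in> ?F" "w = edge_path e t" "t \<in> {0..1}" using e Inner by simp_all
      then show ?thesis by blast
    qed
  next
    fix w assume w: "w \<in> Vertex ` X \<union> \<Union>((\<lambda>e. edge_path e ` {0..1}) ` ?F)"
    then show "w \<in> topspace ?K - open_star E (V - X)"
    proof
      assume "w \<in> Vertex ` X"
      then show ?thesis
        using X unfolding topspace_one_complex[OF G] by (auto simp: complex_points_def open_star_def)
    next
      assume "w \<in> \<Union>((\<lambda>e. edge_path e ` {0..1}) ` ?F)"
      then obtain e t where e: "e \<in> E" "e \<subseteq> X" "w = edge_path e t" by auto
      then show ?thesis
        using edge_path_in_complex_points[OF G e(1)] simple_graph_ends[OF G e(1)]
        unfolding topspace_one_complex[OF G] by (auto simp: open_star_def edge_path_def)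
    qed
  qed
  have "finite ?F" using X(1) by (intro finite_subset[of ?F "Pow X"]) auto
  moreover have "compactin ?K (edge_path e ` {0..1})" if "e \<in> ?F" for e
    by (rule image_compactin[OF _ continuous_map_edge_path[OF G]])
      (use that in \<open>simp_all add: compactin_subtopology\<close>)
  ultimately have "compactin ?K (\<Union>((\<lambda>e. edge_path e ` {0..1}) ` ?F))"
    by (intro compactin_Union) auto
  moreover have "compactin ?K (Vertex ` X)"
    using X by (intro finite_imp_compactin)
      (auto simp: topspace_one_complex[OF G] complex_points_def)
  ultimately show ?thesis unfolding outside by (simp add: compactin_Un)
qed


section \<open>Components of the graph\<close>

lemma joined_refl: "u \<in> U \<Longrightarrow> joined E U u u"
  by (simp add: joined_def)

lemma joined_in: "joined E U u v \<Longrightarrow> u \<in> U" "joined E U u v \<Longrightarrow> v \<in> U"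
  by (simp_all add: joined_def)

lemma joined_trans: "joined E U u v \<Longrightarrow> joined E U v w \<Longrightarrow> joined E U u w"
  unfolding joined_def by (meson rtranclp_trans)

lemma joined_edge: "u \<in> U \<Longrightarrow> v \<in> U \<Longrightarrow> {u, v} \<in> E \<Longrightarrow> joined E U u v"
  unfolding joined_def by (simp add: r_into_rtranclp)

lemma joined_sym:
  assumes "joined E U u v"
  shows "joined E U v u"
proof -
  have "symp (\<lambda>x y. x \<in> U \<and> y \<in> U \<and> {x, y} \<in> E)"
    by (auto simp: symp_def insert_commute)
  then have "symp (\<lambda>x y. x \<in> U \<and> y \<in> U \<and> {x, y} \<in> E)\<^sup>*\<^sup>*" by (rule symp_rtranclp)
  then show ?thesis using assms unfolding joined_def by (blast dest: sympD)
qed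

lemma joined_mono: "joined E U u v \<Longrightarrow> U \<subseteq> U' \<Longrightarrow> joined E U' u v"
  unfolding joined_def
  by (auto elim!: rtranclp_mono[THEN predicate2D, rotated])

lemma joined_equiv: "equiv U {(u, v). joined E U u v}"
  by (rule equivI)
    (auto simp: refl_on_def sym_def trans_def intro: joined_refl joined_sym joined_trans dest: joined_in)

lemma Union_graph_components: "\<Union>(graph_components V E X) = V - X"
  unfolding graph_components_def by (rule Union_quotient[OF joined_equiv])

lemma graph_component_subset: "C \<in> graph_components V E X \<Longrightarrow> C \<subseteq> V - X"
  using Union_graph_components[of V E X] by blast

lemma graph_component_nonempty: "C \<in> graph_components V E X \<Longrightarrow> C \<noteq> {}"
  unfolding graph_components_def by (rule in_quotient_imp_non_empty[OF joined_equiv])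

lemma graph_component_unique:
  assumes "C \<in> graph_components V E X" "D \<in> graph_components V E X" "x \<in> C" "x \<in> D"
  shows "C = D"
  using quotient_disj[OF joined_equiv, of C "V - X" E D] assms unfolding graph_components_def by blast

lemma graph_component_joined:
  assumes "C \<in> graph_components V E X" "u \<in> C"
  shows "v \<in> C \<longleftrightarrow> joined E (V - X) u v"
proof
  assume "v \<in> C"
  then have "(u, v) \<in> {(u, v). joined E (V - X) u v}"
    using quotient_eq_iff[OF joined_equiv, of C "V - X" E C u v] assms
    unfolding graph_components_def by blast
  then show "joined E (V - X) u v" by simp
next
  assume "joined E (V - X) u v"
  then show "v \<in> C"
    using in_quotient_imp_closed[OF joined_equiv, of C "V - X" E u v] assms
    unfolding graph_components_def by blast
qed

lemma graph_component_edge_closed: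
  assumes G: "simple_graph V E" and C: "C \<in> graph_components V E X"
    and e: "e \<in> E" and u: "u \<in> e" "u \<in> C" and v: "v \<in> e" "v \<notin> X"
  shows "v \<in> C"
proof (cases "v = u")
  case False
  then have "e = {u, v}" using simple_graph_ends[OF G e] u v by auto
  moreover have "u \<in> V - X" using graph_component_subset[OF C] u by auto
  moreover have "v \<in> V - X" using simple_graph_edge_subset[OF G e] v by auto
  ultimately have "joined E (V - X) u v" using e by (intro joined_edge) auto
  then show ?thesis using graph_component_joined[OF C u(2)] by simp
qed (use u in simp)

lemma component_map_in:
  assumes "X \<subseteq> X'" and C': "C' \<in> graph_components V E X'"
  shows "component_map V E X' X C' \<in> graph_components V E X" "C' \<subseteq> component_map V E X' X C'"
proof -
  obtain u where u: "u \<in> C'" using graph_component_nonempty[OF C'] by blast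
  then have "u \<in> \<Union>(graph_components V E X)"
    using graph_component_subset[OF C'] \<open>X \<subseteq> X'\<close> by (auto simp: Union_graph_components)
  then obtain C where C: "C \<in> graph_components V E X" "u \<in> C" by blast
  have "C' \<subseteq> C"
  proof
    fix v assume "v \<in> C'"
    then have "joined E (V - X') u v" using graph_component_joined[OF C' u] by simp
    then have "joined E (V - X) u v" by (rule joined_mono) (use \<open>X \<subseteq> X'\<close> in auto)
    then show "v \<in> C" using graph_component_joined[OF C] by simp
  qed
  then have "C \<in> graph_components V E X \<and> C' \<subseteq> C" using C by simp
  then have "component_map V E X' X C' \<in> graph_components V E X \<and> C' \<subseteq> component_map V E X' X C'"
    unfolding component_map_def
  proof (rule theI)
    fix D assume "D \<in> graph_components V E X \<and> C' \<subseteq> D"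
    then show "D = C" using graph_component_unique[OF _ C(1), of D u] u C(2) by blast
  qed
  then show "component_map V E X' X C' \<in> graph_components V E X" "C' \<subseteq> component_map V E X' X C'"
    by simp_all
qed

definition component_at :: "'a set \<Rightarrow> 'a set set \<Rightarrow> 'a set \<Rightarrow> 'a complex_point \<Rightarrow> 'a set"
  where "component_at V E X w = (THE C. C \<in> graph_components V E X \<and> w \<in> open_star E C)"

lemma component_at_eqI:
  assumes G: "simple_graph V E" and C: "C \<in> graph_components V E X" "w \<in> open_star E C"
  shows "component_at V E X w = C"
  unfolding component_at_def
proof (rule the_equality)
  fix D assume "D \<in> graph_components V E X \<and> w \<in> open_star E D"
  then have D: "D \<in> graph_components V E X" "w \<in> open_star E D" by simp_all
  show "D = C"
  proof (cases w)
    case (Vertex v)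
    then show ?thesis using graph_component_unique[OF D(1) C(1)] C D by auto
  next
    case (Inner e t)
    then obtain u v where "e \<in> E" "u \<in> e" "u \<in> C" "v \<in> e" "v \<in> D" using C D by auto
    moreover from this have "v \<notin> X" using graph_component_subset[OF D(1)] by auto
    ultimately have "v \<in> C" using graph_component_edge_closed[OF G C(1)] by blast
    then show ?thesis using graph_component_unique[OF D(1) C(1)] \<open>v \<in> D\<close> by auto
  qed
qed (use C in simp)

lemma component_at_in:
  assumes G: "simple_graph V E" and w: "w \<in> open_star E (V - X)"
  shows "component_at V E X w \<in> graph_components V E X" "w \<in> open_star E (component_at V E X w)"
proof -
  obtain C where "C \<in> graph_components V E X" "w \<in> open_star E C"
    using w unfolding Union_graph_components[of V E X, symmetric] open_star_Union by blast
  then show "component_at V E X w \<in> graph_components V E X" "w \<in> open_star E (component_at V E X w)"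
    using component_at_eqI[OF G] by simp_all
qed

lemma continuous_map_component_at:
  assumes G: "simple_graph V E"
  shows "continuous_map (subtopology (one_complex V E) (open_star E (V - X)))
    (component_space V E X) (component_at V E X)"
  unfolding continuous_map_def
proof (intro conjI allI impI)
  let ?S = "subtopology (one_complex V E) (open_star E (V - X))"
  have top: "topspace ?S = open_star E (V - X)"
    using openin_subset[OF openin_open_star[of "V - X" V E]] by auto
  show "component_at V E X \<in> topspace ?S \<rightarrow> topspace (component_space V E X)"
    unfolding top using component_at_in(1)[OF G] by (simp add: component_space_def Pi_iff)
  fix \<A> assume "openin (component_space V E X) \<A>"
  then have A: "\<A> \<subseteq> graph_components V E X" by (simp add: component_space_def)
  have "{w \<in> open_star E (V - X). component_at V E X w \<in> \<A>} = open_star E (\<Union>\<A>)"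
  proof (intro equalityI subsetI)
    fix w assume "w \<in> {w \<in> open_star E (V - X). component_at V E X w \<in> \<A>}"
    then show "w \<in> open_star E (\<Union>\<A>)"
      using component_at_in(2)[OF G, where w = w and X = X] unfolding open_star_Union by blast
  next
    fix w assume "w \<in> open_star E (\<Union>\<A>)"
    then obtain C where C: "C \<in> \<A>" "w \<in> open_star E C" unfolding open_star_Union by blast
    then have "C \<in> graph_components V E X" using A by blast
    moreover from this have "w \<in> open_star E (V - X)"
      using C(2) open_star_mono[OF graph_component_subset] by blast
    ultimately show "w \<in> {w \<in> open_star E (V - X). component_at V E X w \<in> \<A>}"
      using component_at_eqI[OF G _ C(2), where X = X] C(1) by simp
  qed
  moreover have "openin (one_complex V E) (open_star E (\<Union>\<A>))"
    using A graph_component_subset by (intro openin_open_star) blast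
  ultimately show "openin ?S {w \<in> topspace ?S. component_at V E X w \<in> \<A>}"
    unfolding top using openin_open_star[of "V - X" V E] openin_subset
    by (subst openin_open_subtopology) auto
qed

lemma in_star_iff:
  "Vertex u \<in> star E v i \<longleftrightarrow> u = v \<and> incident E v \<noteq> {}"
  "Inner e t \<in> star E v i \<longleftrightarrow> e \<in> incident E v \<and> 0 < t \<and> t < 1 \<and> (if v = tail e then t < i e else i e < t)"
  by (auto simp: star_def half_open_segment_def)

text \<open>
  Removing stars around the vertices of \<open>X\<close> only shortens the edges between \<open>C\<close> and \<open>X\<close> at their
  ends in \<open>X\<close>.  What is left of such an edge is a segment that still hangs on its end in \<open>C\<close>, and
  all edges inside \<open>C\<close> are intact.
\<close>

lemma connectedin_component_minus_stars:
  assumes G: "simple_graph V E" and C: "C \<in> graph_components V E X"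
  shows "connectedin (one_complex V E) (open_star E C - (\<Union>x\<in>X. star E x (i x)))"
proof -
  let ?K = "one_complex V E" and ?T = "open_star E C - (\<Union>x\<in>X. star E x (i x))"
  let ?S = "subtopology ?K ?T"
  have CV: "C \<subseteq> V - X" by (rule graph_component_subset[OF C])
  have TK: "?T \<subseteq> topspace ?K"
    using openin_subset[OF openin_open_star[of C V E]] CV by blast
  \<comment> \<open>Connectedness inside the set is transported along segments of edges.\<close>
  have segment: "connected_component_of ?S (edge_path e a) (edge_path e b)"
    if "e \<in> E" "0 \<le> a" "a \<le> b" "b \<le> 1" "edge_path e ` {a..b} \<subseteq> ?T" for e a b
  proof -
    have "connectedin (top_of_set {0..1}) {a..b}"
      using that by (auto simp: connectedin_subtopology)
    then have "connectedin ?K (edge_path e ` {a..b})"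
      by (rule connectedin_continuous_map_image[OF continuous_map_edge_path[OF G that(1)]])
    then have "connectedin ?S (edge_path e ` {a..b})"
      using that(5) by (simp add: connectedin_subtopology)
    then show ?thesis
      unfolding connected_component_of_def using that by (intro exI[of _ "edge_path e ` {a..b}"]) auto
  qed
  have vertex_in: "Vertex v \<in> ?T" if "v \<in> C" for v
    using that CV by (auto simp: in_star_iff)
  have step: "connected_component_of ?S (Vertex u) (Vertex v)"
    if "u \<in> C" "v \<in> C" "{u, v} \<in> E" for u v
  proof -
    let ?e = "{u, v}"
    note ends = simple_graph_ends[OF G that(3)]
    have disj: "x \<notin> ?e" if "x \<in> X" for x using that \<open>u \<in> C\<close> \<open>v \<in> C\<close> CV by auto
    have "edge_path ?e t \<in> ?T" if "t \<in> {0..1}" for t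
    proof -
      have ht: "tail ?e \<in> C" "head ?e \<in> C" using ends(1)[of "tail ?e"] ends(1)[of "head ?e"] \<open>u \<in> C\<close> \<open>v \<in> C\<close> by auto
      consider "t = 0" | "t = 1" | "0 < t" "t < 1" using \<open>t \<in> {0..1}\<close> by fastforce
      then show ?thesis
      proof cases
        case 3
        then show ?thesis
          using disj \<open>{u, v} \<in> E\<close> \<open>u \<in> C\<close> by (auto simp: in_star_iff incident_def)
      qed (use vertex_in ht in simp_all)
    qed
    then have "connected_component_of ?S (edge_path ?e 0) (edge_path ?e 1)"
      using that by (intro segment) auto
    then have "connected_component_of ?S (Vertex (tail ?e)) (Vertex (head ?e))" by simp
    moreover have "u = tail ?e \<and> v = head ?e \<or> u = head ?e \<and> v = tail ?e"
      using ends(1)[of u] ends(1)[of v] ends(1)[of "tail ?e"] ends(1)[of "head ?e"] ends(2) by auto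
    ultimately show ?thesis by (auto intro: connected_component_of_sym[THEN iffD1])
  qed
  have vertices: "connected_component_of ?S (Vertex u) (Vertex v)" if u: "u \<in> C" and v: "v \<in> C" for u v
  proof -
    have "(\<lambda>x y. x \<in> V - X \<and> y \<in> V - X \<and> {x, y} \<in> E)\<^sup>*\<^sup>* u v"
      using graph_component_joined[OF C u] v by (simp add: joined_def)
    then have "v \<in> C \<and> connected_component_of ?S (Vertex u) (Vertex v)"
    proof (induction rule: rtranclp_induct)
      case base
      then show ?case
        using u vertex_in[OF u] TK by (auto simp: connected_component_of_refl)
    next
      case (step y z)
      have "z \<in> C"
        by (rule graph_component_edge_closed[OF G C, of "{y, z}" y z]) (use step in auto)
      then have "connected_component_of ?S (Vertex y) (Vertex z)"
        using step \<open>\<And>u v. u \<in> C \<Longrightarrow> v \<in> C \<Longrightarrow> {u, v} \<in> E \<Longrightarrow> _ u v\<close> by blast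
      then show ?case
        using step.IH \<open>z \<in> C\<close> connected_component_of_trans[of ?S "Vertex u" "Vertex y" "Vertex z"] by blast
    qed
    then show ?thesis by simp
  qed
  \<comment> \<open>A point of an edge is moved to an end \<open>y\<close> of the edge in \<open>C\<close>.  If the other end \<open>x\<close> is in \<open>X\<close>,
    its star is a segment at \<open>x\<close> that misses the point, so it misses everything between the point
    and \<open>y\<close>.\<close>
  have to_vertex: "\<exists>v\<in>C. connected_component_of ?S w (Vertex v)" if w: "w \<in> ?T" for w
  proof (cases w)
    case (Vertex v)
    then show ?thesis using w vertices by auto
  next
    case (Inner e t)
    then obtain y where y: "y \<in> e" "y \<in> C" and e: "e \<in> E" and t: "0 < t" "t < 1"
      using w by auto
    have outside: "Inner e t \<notin> star E x (i x)" if "x \<in> X" for x using w Inner that by blast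
    note ends = simple_graph_ends[OF G e]
    show ?thesis
    proof (cases "y = tail e")
      case True
      have "edge_path e s \<in> ?T" if "s \<in> {0..t}" for s
      proof (cases "s = 0")
        case True
        then show ?thesis using vertex_in[OF y(2)] \<open>y = tail e\<close> by simp
      next
        case False
        then have s: "0 < s" "s < 1" using that t by auto
        have "Inner e s \<notin> star E x (i x)" if "x \<in> X" for x
        proof -
          have "x \<noteq> tail e" using that True y CV by auto
          then show ?thesis
            using outside[OF that] t s \<open>s \<in> {0..t}\<close> by (auto simp: in_star_iff)
        qed
        then show ?thesis using s e y by auto
      qed
      then have "connected_component_of ?S (edge_path e 0) (edge_path e t)"
        using t e by (intro segment) auto
      then have "connected_component_of ?S w (Vertex y)"
        using t Inner True by (simp add: connected_component_of_sym)
      then show ?thesis using y by blast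
    next
      case False
      then have yh: "y = head e" using ends y by auto
      have "edge_path e s \<in> ?T" if "s \<in> {t..1}" for s
      proof (cases "s = 1")
        case True
        then show ?thesis using vertex_in[OF y(2)] yh by simp
      next
        case False
        then have s: "0 < s" "s < 1" using that t by auto
        have "Inner e s \<notin> star E x (i x)" if "x \<in> X" for x
        proof -
          have "x \<in> e \<Longrightarrow> x = tail e" using that yh y CV ends by auto
          then show ?thesis
            using outside[OF that] t s \<open>s \<in> {t..1}\<close> by (auto simp: in_star_iff incident_def)
        qed
        then show ?thesis using s e y by auto
      qed
      then have "connected_component_of ?S (edge_path e t) (edge_path e 1)"
        using t e by (intro segment) auto
      then have "connected_component_of ?S w (Vertex y)"
        using t Inner yh by simp
      then show ?thesis using y by blast
    qed
  qed
  have "connected_component_of ?S a b" if ab: "a \<in> ?T" "b \<in> ?T" for a b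
  proof -
    obtain u where u: "u \<in> C" "connected_component_of ?S a (Vertex u)" using to_vertex[OF ab(1)] by blast
    obtain v where v: "v \<in> C" "connected_component_of ?S b (Vertex v)" using to_vertex[OF ab(2)] by blast
    have "connected_component_of ?S a (Vertex v)"
      using u(2) vertices[OF u(1) v(1)] by (rule connected_component_of_trans)
    moreover have "connected_component_of ?S (Vertex v) b"
      using v(2) by (simp add: connected_component_of_sym)
    ultimately show ?thesis by (rule connected_component_of_trans)
  qed
  then have "connected_space ?S"
    unfolding connected_space_iff_connected_component using TK by auto
  then show ?thesis using TK by (simp add: connectedin_def)
qed


section \<open>The map from the remainder to the tangle space\<close>

lemma stone_cech_closure_vanishing:
  assumes p: "p \<in> stone_cech X closure_of (sc_embed X ` S)" and f: "f \<in> unit_maps X"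
    and zero: "\<And>x. x \<in> S \<Longrightarrow> f x = 0"
  shows "p f = 0"
proof (rule antisym)
  show "p f \<le> 0"
    by (rule stone_cech_closure_leI[where F = "\<lambda>p. p f" and G = "\<lambda>_. 0", OF p continuous_map_stone_cech_eval[OF f]])
      (use f zero in simp_all)
  show "0 \<le> p f"
    by (rule stone_cech_eval_bounds(1)[OF subsetD[OF closure_of_subset_topspace p] f])
qed

lemma topspace_stone_cech_remainder:
  "topspace (stone_cech_remainder K) = topspace (stone_cech K) - sc_embed K ` topspace K"
  by (auto simp: stone_cech_remainder_def)

text \<open>
  \<open>\<phi>\<close> sends each point \<open>p\<close> of the remainder to an ultrafilter on the components of \<open>G - X\<close>: a set
  of components is large if \<open>p\<close> is in the closure of the part of the 1-complex that it covers.
\<close>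

definition side_map ::
    "'a set \<Rightarrow> 'a set set \<Rightarrow> 'a set \<Rightarrow> ((('a complex_point \<Rightarrow> real) \<Rightarrow> real) \<Rightarrow> ('a set \<Rightarrow> real) \<Rightarrow> real) \<Rightarrow> bool"
  where "side_map V E X \<phi> \<longleftrightarrow>
    continuous_map (stone_cech_remainder (one_complex V E)) (stone_cech (component_space V E X)) \<phi> \<and>
    (\<forall>p \<in> topspace (stone_cech_remainder (one_complex V E)). \<forall>\<A> \<subseteq> graph_components V E X.
      large_set (graph_components V E X) (\<phi> p) \<A> \<longleftrightarrow>
      p \<in> stone_cech (one_complex V E) closure_of (sc_embed (one_complex V E) ` open_star E (\<Union>\<A>)))"

text \<open>
  The map that sends a point of the 1-complex to its component of \<open>G - X\<close> is defined off the finite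
  subgraph on \<open>X\<close>, so it extends to the remainder.  The indicator function of \<open>\<A>\<close>, pulled back and
  weighted by \<open>\<eta>\<close> with \<open>p \<eta> = 1\<close>, equals \<open>\<eta>\<close> on the open star of \<open>\<A>\<close> and 0 off it, so its value
  at \<open>p\<close> decides whether \<open>p\<close> is in the closure of that star.
\<close>

lemma side_map_exists:
  assumes G: "simple_graph V E" and X: "finite X" "X \<subseteq> V"
  shows "\<exists>\<phi>. side_map V E X \<phi>"
proof -
  let ?K = "one_complex V E" and ?W = "open_star E (V - X)" and ?D = "graph_components V E X"
  let ?c = "component_at V E X"
  have W: "openin ?K ?W" by (rule openin_open_star) auto
  have c: "continuous_map (subtopology ?K ?W) (component_space V E X) ?c"
    by (rule continuous_map_component_at[OF G])
  note cpt = compactin_outside_open_star[OF G X]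
  obtain \<phi> where \<phi>: "continuous_map (stone_cech_remainder ?K) (stone_cech (component_space V E X)) \<phi>"
    and formula: "\<And>p \<eta> f. p \<in> topspace (stone_cech_remainder ?K) \<Longrightarrow> \<eta> \<in> vanishing_maps ?K ?W \<Longrightarrow>
      f \<in> unit_maps (component_space V E X) \<Longrightarrow> p (weighted_pullback ?K ?W ?c \<eta> f) = p \<eta> * \<phi> p f"
    using stone_cech_remainder_extension[OF W cpt c] by blast
  have "large_set ?D (\<phi> p) \<A> \<longleftrightarrow> p \<in> stone_cech ?K closure_of (sc_embed ?K ` open_star E (\<Union>\<A>))"
    if p: "p \<in> topspace (stone_cech_remainder ?K)" and A: "\<A> \<subseteq> ?D" for p \<A>
  proof -
    let ?f = "indicator_map ?D \<A>"
    have pB: "p \<in> topspace (stone_cech ?K)" using p by (simp add: topspace_stone_cech_remainder)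
    have f: "?f \<in> unit_maps (component_space V E X)"
      unfolding component_space_def by (rule indicator_map_in_unit_maps)
    obtain \<eta> where \<eta>: "\<eta> \<in> vanishing_maps ?K ?W" "p \<eta> = 1"
      using vanishing_map_peak[OF p openin_subset[OF W] cpt] by blast
    then have \<eta>u: "\<eta> \<in> unit_maps ?K" by (simp add: vanishing_maps_def)
    let ?g = "weighted_pullback ?K ?W ?c \<eta> ?f"
    have g: "?g \<in> unit_maps ?K" by (rule weighted_pullback_in_unit_maps[OF W c \<eta>(1) f])
    have value_g: "p ?g = \<phi> p ?f" using formula[OF p \<eta>(1) f] \<eta>(2) by simp
    have sub: "\<Union>\<A> \<subseteq> V - X" using A graph_component_subset by blast
    have g_on: "?g w = \<eta> w" if w: "w \<in> open_star E (\<Union>\<A>)" for w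
    proof -
      have wW: "w \<in> ?W" using w open_star_mono[OF sub] by (rule subsetD[rotated])
      obtain C where C: "C \<in> \<A>" "w \<in> open_star E C" using w unfolding open_star_Union by blast
      then have "?c w = C" using component_at_eqI[OF G _ C(2)] A by blast
      then show ?thesis
        using wW C(1) A subsetD[OF openin_subset[OF W] wW] by (auto simp: weighted_pullback_def indicator_map_def)
    qed
    have g_off: "w \<in> open_star E (\<Union>\<A>)" if "w \<in> topspace ?K" "0 < ?g w" for w
    proof -
      have wW: "w \<in> ?W" and "?f (?c w) \<noteq> 0"
        using that by (auto simp: weighted_pullback_def split: if_splits)
      then have "?c w \<in> \<A>"
        using component_at_in(1)[OF G wW] by (auto simp: indicator_map_def split: if_splits)
      then show ?thesis using component_at_in(2)[OF G wW] unfolding open_star_Union by blast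
    qed
    show ?thesis
    proof
      assume "large_set ?D (\<phi> p) \<A>"
      then have "0 < p ?g" using value_g by (simp add: large_set_def)
      then have "p \<in> stone_cech ?K closure_of (sc_embed ?K ` {w \<in> topspace ?K. 0 < ?g w})"
        by (rule in_closure_of_superlevel[OF pB g])
      also have "\<dots> \<subseteq> stone_cech ?K closure_of (sc_embed ?K ` open_star E (\<Union>\<A>))"
        by (intro closure_of_mono image_mono subsetI) (use g_off in simp)
      finally show "p \<in> stone_cech ?K closure_of (sc_embed ?K ` open_star E (\<Union>\<A>))" .
    next
      assume cl: "p \<in> stone_cech ?K closure_of (sc_embed ?K ` open_star E (\<Union>\<A>))"
      have "p \<eta> \<le> p ?g"
        by (rule stone_cech_closure_leI[where F = "\<lambda>p. p \<eta>" and G = "\<lambda>p. p ?g",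
              OF cl continuous_map_stone_cech_eval[OF \<eta>u] continuous_map_stone_cech_eval[OF g]])
          (use \<eta>u g g_on in simp)
      then have "1 \<le> \<phi> p ?f" using value_g \<eta>(2) by simp
      moreover have "\<phi> p \<in> topspace (stone_cech (discrete_topology ?D))"
        using \<phi> p by (simp add: continuous_map_def component_space_def Pi_iff)
      then have "\<phi> p ?f \<in> {0, 1}" by (rule eval_indicator_binary)
      ultimately show "large_set ?D (\<phi> p) \<A>" using A by (auto simp: large_set_def)
    qed
  qed
  then have "side_map V E X \<phi>" using \<phi> unfolding side_map_def by simp
  then show ?thesis by blast
qed

definition tangle_map ::
    "'a set \<Rightarrow> 'a set set \<Rightarrow> (('a complex_point \<Rightarrow> real) \<Rightarrow> real) \<Rightarrow> 'a set \<Rightarrow> ('a set \<Rightarrow> real) \<Rightarrow> real"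
  where "tangle_map V E p = (\<lambda>X\<in>{X. finite X \<and> X \<subseteq> V}. (SOME \<phi>. side_map V E X \<phi>) p)"

lemma side_map_tangle_map:
  assumes G: "simple_graph V E" and X: "finite X" "X \<subseteq> V"
  shows "side_map V E X (\<lambda>p. tangle_map V E p X)"
proof -
  have "side_map V E X (SOME \<phi>. side_map V E X \<phi>)"
    by (rule someI_ex[OF side_map_exists[OF G X]])
  moreover have "(\<lambda>p. tangle_map V E p X) = (SOME \<phi>. side_map V E X \<phi>)"
    using X by (simp add: tangle_map_def fun_eq_iff)
  ultimately show ?thesis by simp
qed

lemma continuous_map_tangle_coordinate:
  assumes "simple_graph V E" "finite X" "X \<subseteq> V"
  shows "continuous_map (stone_cech_remainder (one_complex V E)) (stone_cech (component_space V E X))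
    (\<lambda>p. tangle_map V E p X)"
  using side_map_tangle_map[OF assms] by (simp add: side_map_def)

lemma large_set_tangle_map_iff:
  assumes "simple_graph V E" "finite X" "X \<subseteq> V" "p \<in> topspace (stone_cech_remainder (one_complex V E))"
    "\<A> \<subseteq> graph_components V E X"
  shows "large_set (graph_components V E X) (tangle_map V E p X) \<A> \<longleftrightarrow>
      p \<in> stone_cech (one_complex V E) closure_of (sc_embed (one_complex V E) ` open_star E (\<Union>\<A>))"
  using side_map_tangle_map[OF assms(1,2,3)] assms(4,5) by (simp add: side_map_def)

lemma tangle_map_in_stone_cech:
  assumes "simple_graph V E" "finite X" "X \<subseteq> V" "p \<in> topspace (stone_cech_remainder (one_complex V E))"
  shows "tangle_map V E p X \<in> topspace (stone_cech (component_space V E X))"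
  using continuous_map_tangle_coordinate[OF assms(1,2,3)] assms(4) by (simp add: continuous_map_def Pi_iff)

lemma in_tangle_space_iff:
  "\<tau> \<in> topspace (tangle_space V E) \<longleftrightarrow>
    \<tau> \<in> (\<Pi>\<^sub>E X\<in>{X. finite X \<and> X \<subseteq> V}. topspace (stone_cech (component_space V E X))) \<and>
    (\<forall>X X'. finite X' \<longrightarrow> X' \<subseteq> V \<longrightarrow> X \<subseteq> X' \<longrightarrow>
      stone_cech_map (component_space V E X') (component_space V E X) (component_map V E X' X) (\<tau> X') = \<tau> X)"
proof -
  have pairs: "(\<forall>X\<in>{X. finite X \<and> X \<subseteq> V}. \<forall>X'\<in>{X. finite X \<and> X \<subseteq> V}. X \<subseteq> X' \<longrightarrow> P X X') \<longleftrightarrow>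
      (\<forall>X X'. finite X' \<longrightarrow> X' \<subseteq> V \<longrightarrow> X \<subseteq> X' \<longrightarrow> P X X')"
    (is "?l \<longleftrightarrow> ?r") for P
  proof (intro iffI allI impI)
    fix X X' assume l: "?l" and X': "finite X'" "X' \<subseteq> V" and "X \<subseteq> X'"
    have "finite X" by (rule finite_subset[OF \<open>X \<subseteq> X'\<close> X'(1)])
    moreover have "X \<subseteq> V" using \<open>X \<subseteq> X'\<close> X'(2) by (rule order_trans)
    ultimately have in_index: "X \<in> {X. finite X \<and> X \<subseteq> V}" "X' \<in> {X. finite X \<and> X \<subseteq> V}"
      using X' by simp_all
    show "P X X'" by (rule l[rule_format, OF in_index \<open>X \<subseteq> X'\<close>])
  next
    assume "?r"
    then show "?l" by simp
  qed
  show ?thesis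
    unfolding tangle_space_def inverse_limit_def topspace_subtopology topspace_product_topology
      Int_iff mem_Collect_eq pairs o_def by (rule refl)
qed

lemma large_set_bonding_map_iff:
  assumes "X \<subseteq> X'" "u \<in> topspace (stone_cech (component_space V E X'))" "\<A> \<subseteq> graph_components V E X"
  shows "large_set (graph_components V E X)
      (stone_cech_map (component_space V E X') (component_space V E X) (component_map V E X' X) u) \<A> \<longleftrightarrow>
    large_set (graph_components V E X') u {C \<in> graph_components V E X'. component_map V E X' X C \<in> \<A>}"
  unfolding component_space_def
  by (rule large_set_stone_cech_map) (use assms component_map_in(1) in \<open>auto simp: component_space_def\<close>)

text \<open>
  The coordinates are compatible because an open star of components of \<open>G - X'\<close> is included in
  the open star of the components of \<open>G - X\<close> to which they are mapped.
\<close>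

lemma continuous_map_tangle_map:
  assumes G: "simple_graph V E"
  shows "continuous_map (stone_cech_remainder (one_complex V E)) (tangle_space V E) (tangle_map V E)"
proof -
  let ?K = "one_complex V E" and ?R = "stone_cech_remainder (one_complex V E)"
  let ?S = "component_space V E" and ?D = "graph_components V E"
  have compatible: "stone_cech_map (?S X') (?S X) (component_map V E X' X) (tangle_map V E p X') = tangle_map V E p X"
    if p: "p \<in> topspace ?R" and X': "finite X'" "X' \<subseteq> V" and "X \<subseteq> X'" for p X X'
  proof -
    have X: "finite X" "X \<subseteq> V" using X' \<open>X \<subseteq> X'\<close> finite_subset by auto
    note in' = tangle_map_in_stone_cech[OF G X' p]
    have \<kappa>: "continuous_map (?S X') (?S X) (component_map V E X' X)"
      using component_map_in(1)[OF \<open>X \<subseteq> X'\<close>] by (simp add: component_space_def Pi_iff)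
    show ?thesis
    proof (rule stone_cech_discrete_eqI[where D = "?D X"])
      show "stone_cech_map (?S X') (?S X) (component_map V E X' X) (tangle_map V E p X')
          \<in> topspace (stone_cech (discrete_topology (?D X)))"
        using stone_cech_map(1)[OF \<kappa>] in' unfolding component_space_def[symmetric]
        by (simp add: continuous_map_def Pi_iff)
      show "tangle_map V E p X \<in> topspace (stone_cech (discrete_topology (?D X)))"
        using tangle_map_in_stone_cech[OF G X p] by (simp add: component_space_def)
      fix \<A> assume large: "large_set (?D X)
        (stone_cech_map (?S X') (?S X) (component_map V E X' X) (tangle_map V E p X')) \<A>"
      then have A: "\<A> \<subseteq> ?D X" by (simp add: large_set_def)
      let ?\<A>' = "{C \<in> ?D X'. component_map V E X' X C \<in> \<A>}"
      have "large_set (?D X') (tangle_map V E p X') ?\<A>'"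
        using large large_set_bonding_map_iff[OF \<open>X \<subseteq> X'\<close> in' A] by simp
      then have "p \<in> stone_cech ?K closure_of (sc_embed ?K ` open_star E (\<Union>?\<A>'))"
        using large_set_tangle_map_iff[OF G X' p, of ?\<A>'] by auto
      moreover have "\<Union>?\<A>' \<subseteq> \<Union>\<A>" using component_map_in(2)[OF \<open>X \<subseteq> X'\<close>] by blast
      then have "stone_cech ?K closure_of (sc_embed ?K ` open_star E (\<Union>?\<A>'))
          \<subseteq> stone_cech ?K closure_of (sc_embed ?K ` open_star E (\<Union>\<A>))"
        by (intro closure_of_mono image_mono open_star_mono)
      ultimately show "large_set (?D X) (tangle_map V E p X) \<A>"
        using large_set_tangle_map_iff[OF G X p A] by auto
    qed
  qed
  have "continuous_map ?R (product_topology (\<lambda>X. stone_cech (?S X)) {X. finite X \<and> X \<subseteq> V}) (tangle_map V E)"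
    unfolding continuous_map_componentwise
    using continuous_map_tangle_coordinate[OF G] by (auto simp: tangle_map_def)
  then show ?thesis
    unfolding tangle_space_def inverse_limit_def continuous_map_in_subtopology
    using compatible by (auto simp: Pi_iff)
qed

text \<open>
  Compatibility pulls both sets back to components of \<open>G - (X \<union> Y)\<close>, where they can be
  intersected.
\<close>

lemma large_set_directed:
  assumes \<tau>: "\<tau> \<in> topspace (tangle_space V E)"
    and X: "finite X" "X \<subseteq> V" "large_set (graph_components V E X) (\<tau> X) \<A>"
    and Y: "finite Y" "Y \<subseteq> V" "large_set (graph_components V E Y) (\<tau> Y) \<B>"
  obtains \<C> where "large_set (graph_components V E (X \<union> Y)) (\<tau> (X \<union> Y)) \<C>"
    "\<Union>\<C> \<subseteq> \<Union>\<A> \<inter> \<Union>\<B>"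
proof -
  let ?Z = "X \<union> Y" and ?D = "graph_components V E"
  have Z: "finite ?Z" "?Z \<subseteq> V" using X Y by auto
  have \<tau>Z: "\<tau> ?Z \<in> topspace (stone_cech (component_space V E ?Z))"
    using \<tau> Z by (auto simp: in_tangle_space_iff PiE_iff)
  have lift: "large_set (?D ?Z) (\<tau> ?Z) {C \<in> ?D ?Z. component_map V E ?Z U C \<in> \<U>}"
    if "U \<subseteq> ?Z" "large_set (?D U) (\<tau> U) \<U>" for U \<U>
  proof -
    have "\<U> \<subseteq> ?D U" using that(2) by (simp add: large_set_def)
    moreover have "stone_cech_map (component_space V E ?Z) (component_space V E U) (component_map V E ?Z U) (\<tau> ?Z) = \<tau> U"
      using \<tau> Z that(1) by (simp add: in_tangle_space_iff)
    ultimately show ?thesis using large_set_bonding_map_iff[OF that(1) \<tau>Z] that(2) by simp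
  qed
  show ?thesis
  proof
    show "large_set (?D ?Z) (\<tau> ?Z) ({C \<in> ?D ?Z. component_map V E ?Z X C \<in> \<A>} \<inter> {C \<in> ?D ?Z. component_map V E ?Z Y C \<in> \<B>})"
      using \<tau>Z unfolding component_space_def by (rule large_set_Int) (use lift X(3) Y(3) in auto)
    show "\<Union>({C \<in> ?D ?Z. component_map V E ?Z X C \<in> \<A>} \<inter> {C \<in> ?D ?Z. component_map V E ?Z Y C \<in> \<B>}) \<subseteq> \<Union>\<A> \<inter> \<Union>\<B>"
      using component_map_in(2)[of X ?Z _ V E] component_map_in(2)[of Y ?Z _ V E] by blast
  qed
qed

lemma tangle_eqI:
  assumes \<sigma>: "\<sigma> \<in> topspace (tangle_space V E)" and \<tau>: "\<tau> \<in> topspace (tangle_space V E)"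
    and le: "\<And>X \<A>. finite X \<Longrightarrow> X \<subseteq> V \<Longrightarrow> large_set (graph_components V E X) (\<sigma> X) \<A> \<Longrightarrow>
      large_set (graph_components V E X) (\<tau> X) \<A>"
  shows "\<sigma> = \<tau>"
proof (rule PiE_ext)
  let ?P = "\<Pi>\<^sub>E X\<in>{X. finite X \<and> X \<subseteq> V}. topspace (stone_cech (component_space V E X))"
  show *: "\<sigma> \<in> ?P" "\<tau> \<in> ?P" using \<sigma> \<tau> by (simp_all add: in_tangle_space_iff)
  fix X assume X: "X \<in> {X. finite X \<and> X \<subseteq> V}"
  have "\<sigma> X \<in> topspace (stone_cech (component_space V E X))" "\<tau> X \<in> topspace (stone_cech (component_space V E X))"
    using * X by (auto simp: PiE_iff)
  then show "\<sigma> X = \<tau> X"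
    unfolding component_space_def by (rule stone_cech_discrete_eqI) (use le X in auto)
qed

section \<open>The map is a quotient map\<close>

text \<open>
  The bump function at \<open>v\<close> is 1 at \<open>v\<close> and 0 on \<open>S\<close>.
\<close>

lemma sc_embed_Vertex_notin_closure:
  assumes G: "simple_graph V E" and i: "\<And>e. e \<in> incident E v \<Longrightarrow> 0 < i e \<and> i e < 1" and v: "v \<in> V"
    and S: "S \<subseteq> complex_points V E" "S \<inter> star E v i = {}" "Vertex v \<notin> S"
  shows "sc_embed (one_complex V E) (Vertex v) \<notin>
    stone_cech (one_complex V E) closure_of (sc_embed (one_complex V E) ` S)"
proof
  let ?b = "restrict (star_bump v i) (topspace (one_complex V E))"
  assume cl: "sc_embed (one_complex V E) (Vertex v) \<in> stone_cech (one_complex V E) closure_of (sc_embed (one_complex V E) ` S)"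
  have b: "?b \<in> unit_maps (one_complex V E)" by (rule star_bump_in_unit_maps[OF G i])
  have "?b w = 0" if w: "w \<in> S" for w
  proof -
    have "w \<in> complex_points V E" "w \<notin> star E v i" "w \<noteq> Vertex v" using w S by auto
    then have "star_bump v i w = 0" by (rule star_bump_outside_star[OF G i, rotated])
    then show ?thesis using w S(1) by (auto simp: topspace_one_complex[OF G])
  qed
  then have "sc_embed (one_complex V E) (Vertex v) ?b = 0"
    by (rule stone_cech_closure_vanishing[OF cl b])
  moreover have "Vertex v \<in> topspace (one_complex V E)"
    using v by (simp add: topspace_one_complex[OF G] complex_points_def)
  ultimately show False using b by simp
qed

lemma sc_embed_Inner_notin_closure:
  assumes G: "simple_graph V E" and e: "e \<in> E" "0 < t" "t < 1"
    and S: "S \<subseteq> complex_points V E" "\<And>s. Inner e s \<notin> S"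
  shows "sc_embed (one_complex V E) (Inner e t) \<notin>
    stone_cech (one_complex V E) closure_of (sc_embed (one_complex V E) ` S)"
proof
  let ?b = "restrict (edge_bump e) (topspace (one_complex V E))"
  assume cl: "sc_embed (one_complex V E) (Inner e t) \<in> stone_cech (one_complex V E) closure_of (sc_embed (one_complex V E) ` S)"
  have b: "?b \<in> unit_maps (one_complex V E)" by (rule edge_bump_in_unit_maps[OF G])
  have "?b w = 0" if "w \<in> S" for w
    using that S by (auto simp: topspace_one_complex[OF G] edge_bump_def split: complex_point.split)
  then have "sc_embed (one_complex V E) (Inner e t) ?b = 0"
    by (rule stone_cech_closure_vanishing[OF cl b])
  moreover have "Inner e t \<in> topspace (one_complex V E)"
    using e by (simp add: topspace_one_complex[OF G] complex_points_def)
  ultimately show False using b e by (simp add: edge_bump_def)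
qed

text \<open>
  Under the identification of the closure of the vertex set with \<open>\<beta>V\<close>, these are the free
  ultrafilters on \<open>V\<close>.  The description by complements of finite sets makes them a closed set at
  sight.
\<close>

definition vertex_limit_points ::
    "'a set \<Rightarrow> 'a set set \<Rightarrow> (('a complex_point \<Rightarrow> real) \<Rightarrow> real) set"
  where "vertex_limit_points V E =
    \<Inter>((\<lambda>X. stone_cech (one_complex V E) closure_of (sc_embed (one_complex V E) ` Vertex ` (V - X)))
      ` {X. finite X \<and> X \<subseteq> V})"

text \<open>
  A vertex \<open>v\<close> is excluded by \<open>X = {v}\<close>, and an inner edge point already because the vertex set
  is closed.
\<close>

lemma compactin_vertex_limit_points:
  assumes G: "simple_graph V E"
  shows "compactin (stone_cech_remainder (one_complex V E)) (vertex_limit_points V E)"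
proof -
  let ?K = "one_complex V E" and ?L = "vertex_limit_points V E"
  let ?cl = "\<lambda>X. stone_cech ?K closure_of (sc_embed ?K ` Vertex ` (V - X))"
  have "closedin (stone_cech ?K) ?L"
    unfolding vertex_limit_points_def by (intro closedin_Inter) auto
  then have cpt: "compactin (stone_cech ?K) ?L"
    by (rule closedin_compact_space[OF compact_Hausdorff_stone_cech(1)])
  have sub: "?L \<subseteq> ?cl X" if "finite X" "X \<subseteq> V" for X
    unfolding vertex_limit_points_def using that by blast
  have "sc_embed ?K w \<notin> ?L" if w: "w \<in> topspace ?K" for w
  proof (cases w)
    case (Vertex v)
    then have v: "v \<in> V" using w by (auto simp: topspace_one_complex[OF G] complex_points_def)
    have "sc_embed ?K (Vertex v) \<notin> ?cl {v}"
      by (rule sc_embed_Vertex_notin_closure[OF G _ v, where i = "\<lambda>_. 1/2"])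
        (auto simp: complex_points_def in_star_iff)
    then show ?thesis using sub[of "{v}"] v Vertex by auto
  next
    case (Inner e t)
    then have "e \<in> E" "0 < t" "t < 1" using w by (auto simp: topspace_one_complex[OF G] complex_points_def)
    then have "sc_embed ?K (Inner e t) \<notin> ?cl {}"
      by (rule sc_embed_Inner_notin_closure[OF G]) (auto simp: complex_points_def)
    then show ?thesis using sub[of "{}"] Inner by auto
  qed
  moreover have "?L \<subseteq> topspace (stone_cech ?K)" using cpt by (rule compactin_subset_topspace)
  ultimately have "?L \<subseteq> topspace (stone_cech ?K) - sc_embed ?K ` topspace ?K" by auto
  then show ?thesis using cpt by (simp add: stone_cech_remainder_def compactin_subtopology)
qed

text \<open>
  Every tangle \<open>\<tau>\<close> is the image of a limit of vertices.  The vertex sets \<open>\<Union>\<A>\<close>, with \<open>\<A>\<close> large for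
  \<open>\<tau>\<close> at some \<open>X\<close>, are nonempty and directed downwards, so their closures have a common point by
  compactness; all components of \<open>G - X\<close> together are large, which makes this point a limit of
  vertices outside \<open>X\<close>.
\<close>

lemma tangle_map_vertex_limit_points:
  assumes G: "simple_graph V E"
  shows "tangle_map V E ` vertex_limit_points V E = topspace (tangle_space V E)"
proof (intro equalityI subsetI)
  let ?K = "one_complex V E" and ?L = "vertex_limit_points V E" and ?D = "graph_components V E"
  note LR = compactin_subset_topspace[OF compactin_vertex_limit_points[OF G]]
  have map_in: "tangle_map V E p \<in> topspace (tangle_space V E)"
    if "p \<in> topspace (stone_cech_remainder ?K)" for p
    using continuous_map_tangle_map[OF G] that by (simp add: continuous_map_def Pi_iff)
  show "\<tau> \<in> topspace (tangle_space V E)" if "\<tau> \<in> tangle_map V E ` ?L" for \<tau>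
    using that map_in LR by auto
  fix \<tau> assume \<tau>: "\<tau> \<in> topspace (tangle_space V E)"
  let ?cl = "\<lambda>\<A>. stone_cech ?K closure_of (sc_embed ?K ` Vertex ` \<Union>\<A>)"
  let ?\<F> = "{?cl \<A> |X \<A>. finite X \<and> X \<subseteq> V \<and> large_set (?D X) (\<tau> X) \<A>}"
  have \<tau>X: "\<tau> X \<in> topspace (stone_cech (discrete_topology (?D X)))" if "finite X" "X \<subseteq> V" for X
    using \<tau> that by (auto simp: in_tangle_space_iff PiE_iff component_space_def)
  have all_large: "large_set (?D X) (\<tau> X) (?D X)" if "finite X" "X \<subseteq> V" for X
    by (rule large_set_carrier[OF \<tau>X[OF that]])
  have "\<Inter>?\<F> \<noteq> {}"
  proof
    assume "\<Inter>?\<F> = {}"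
    have "\<exists>F\<in>?\<F>. F \<subseteq> {}"
    proof (rule compact_directed_Inter_subset[OF compact_Hausdorff_stone_cech(1)])
      show "closedin (stone_cech ?K) F" if "F \<in> ?\<F>" for F using that by auto
      have "?cl (?D {}) \<in> ?\<F>" using all_large[of "{}"] by blast
      then show "?\<F> \<noteq> {}" by blast
      show "\<exists>B\<in>?\<F>. B \<subseteq> F \<inter> H" if FH: "F \<in> ?\<F>" "H \<in> ?\<F>" for F H
      proof -
        obtain X \<A> where X: "finite X" "X \<subseteq> V" "large_set (?D X) (\<tau> X) \<A>" and F: "F = ?cl \<A>"
          using FH(1) by blast
        obtain Y \<B> where Y: "finite Y" "Y \<subseteq> V" "large_set (?D Y) (\<tau> Y) \<B>" and H: "H = ?cl \<B>"
          using FH(2) by blast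
        obtain \<C> where C: "large_set (?D (X \<union> Y)) (\<tau> (X \<union> Y)) \<C>" "\<Union>\<C> \<subseteq> \<Union>\<A> \<inter> \<Union>\<B>"
          by (rule large_set_directed[OF \<tau> X Y])
        have "?cl \<C> \<in> ?\<F>" using X(1,2) Y(1,2) C(1) by blast
        moreover have "?cl \<C> \<subseteq> F" "?cl \<C> \<subseteq> H"
          unfolding F H using C(2) by (intro closure_of_mono image_mono, blast)+
        ultimately show ?thesis by blast
      qed
      show "openin (stone_cech ?K) {}" by simp
      show "\<Inter>?\<F> \<subseteq> {}" using \<open>\<Inter>?\<F> = {}\<close> by simp
    qed
    then obtain X \<A> where X: "finite X" "X \<subseteq> V" "large_set (?D X) (\<tau> X) \<A>" and "?cl \<A> \<subseteq> {}"
      by blast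
    have A: "\<A> \<subseteq> ?D X" using X(3) by (simp add: large_set_def)
    have "\<A> \<noteq> {}" using not_large_set_empty[OF \<tau>X[OF X(1,2)]] X(3) by auto
    then obtain v where v: "v \<in> \<Union>\<A>" using A graph_component_nonempty by blast
    have "\<Union>\<A> \<subseteq> V" using A graph_component_subset by blast
    then have "sc_embed ?K ` Vertex ` \<Union>\<A> \<subseteq> topspace (stone_cech ?K)"
      by (auto simp: topspace_one_complex[OF G] complex_points_def intro!: sc_embed_in_stone_cech)
    then have "sc_embed ?K (Vertex v) \<in> ?cl \<A>"
      using closure_of_subset v by blast
    then show False using \<open>?cl \<A> \<subseteq> {}\<close> by blast
  qed
  then obtain p where p: "p \<in> \<Inter>?\<F>" by blast
  have p_in: "p \<in> ?cl \<A>" if "finite X" "X \<subseteq> V" "large_set (?D X) (\<tau> X) \<A>" for X \<A>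
    using p that by blast
  have pL: "p \<in> ?L"
    unfolding vertex_limit_points_def
  proof (intro INT_I)
    fix X assume "X \<in> {X. finite X \<and> X \<subseteq> V}"
    then show "p \<in> stone_cech ?K closure_of (sc_embed ?K ` Vertex ` (V - X))"
      using p_in[OF _ _ all_large, of X] by (simp add: Union_graph_components)
  qed
  have pR: "p \<in> topspace (stone_cech_remainder ?K)" using pL LR by blast
  have "\<tau> = tangle_map V E p"
  proof (rule tangle_eqI[OF \<tau> map_in[OF pR]])
    fix X \<A> assume X: "finite X" "X \<subseteq> V" "large_set (?D X) (\<tau> X) \<A>"
    then have A: "\<A> \<subseteq> ?D X" by (simp add: large_set_def)
    have "p \<in> ?cl \<A>" using X by (rule p_in)
    also have "?cl \<A> \<subseteq> stone_cech ?K closure_of (sc_embed ?K ` open_star E (\<Union>\<A>))"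
      by (intro closure_of_mono image_mono) auto
    finally show "large_set (?D X) (tangle_map V E p X) \<A>"
      using large_set_tangle_map_iff[OF G X(1,2) pR A] by simp
  qed
  then show "\<tau> \<in> tangle_map V E ` ?L" using pL by blast
qed

lemma Hausdorff_tangle_space: "Hausdorff_space (tangle_space V E)"
  unfolding tangle_space_def inverse_limit_def
  by (intro Hausdorff_space_subtopology)
    (simp add: Hausdorff_space_product_topology compact_Hausdorff_stone_cech)

lemma quotient_map_tangle_map:
  assumes G: "simple_graph V E"
  shows "quotient_map (stone_cech_remainder (one_complex V E)) (tangle_space V E) (tangle_map V E)"
  by (rule quotient_map_if_compact_subset_onto[OF continuous_map_tangle_map[OF G]
        compactin_vertex_limit_points[OF G] tangle_map_vertex_limit_points[OF G] Hausdorff_tangle_space])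

section \<open>The fibres are the connected components\<close>

text \<open>
  The coordinates of the tangle map at indicator functions take only the values 0 and 1, so they
  are constant on connected sets.
\<close>

lemma connected_imp_tangle_map_eq:
  assumes G: "simple_graph V E"
    and pq: "connected_component_of (stone_cech_remainder (one_complex V E)) p q"
  shows "tangle_map V E p = tangle_map V E q"
proof -
  let ?R = "stone_cech_remainder (one_complex V E)" and ?D = "graph_components V E"
  have in_R: "p \<in> topspace ?R" "q \<in> topspace ?R"
    using pq by (auto simp: connected_component_of_equiv[of ?R p q])
  have map_in: "tangle_map V E r \<in> topspace (tangle_space V E)" if "r \<in> topspace ?R" for r
    using continuous_map_tangle_map[OF G] that by (simp add: continuous_map_def Pi_iff)
  show ?thesis
  proof (rule tangle_eqI[OF map_in[OF in_R(1)] map_in[OF in_R(2)]])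
    fix X \<A> assume X: "finite X" "X \<subseteq> V" and large: "large_set (?D X) (tangle_map V E p X) \<A>"
    let ?h = "\<lambda>r. tangle_map V E r X (indicator_map (?D X) \<A>)"
    have "?h p = ?h q"
    proof (rule continuous_map_into_binary_imp_component_eq[OF _ _ pq])
      have "continuous_map (stone_cech (component_space V E X)) euclideanreal (\<lambda>u. u (indicator_map (?D X) \<A>))"
        unfolding component_space_def
        by (rule continuous_map_stone_cech_eval[OF indicator_map_in_unit_maps])
      with continuous_map_tangle_coordinate[OF G X] show "continuous_map ?R euclideanreal ?h"
        by (rule continuous_map_compose[unfolded o_def])
      have "?h r \<in> {0, 1}" if "r \<in> topspace ?R" for r
        by (rule eval_indicator_binary[OF tangle_map_in_stone_cech[OF G X that, unfolded component_space_def]])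
      then show "?h ` topspace ?R \<subseteq> {0, 1}" by blast
    qed
    then show "large_set (?D X) (tangle_map V E q X) \<A>" using large by (simp add: large_set_def)
  qed
qed

text \<open>
  The compactification is Hausdorff, so a vertex has a neighbourhood whose closure omits \<open>p\<close> and
  \<open>q\<close>; inside it there is a star.
\<close>

lemma star_avoiding_remainder_points:
  assumes G: "simple_graph V E" and v: "v \<in> V"
    and p: "p \<in> topspace (stone_cech_remainder (one_complex V E))"
    and q: "q \<in> topspace (stone_cech_remainder (one_complex V E))"
  obtains i where "\<And>e. e \<in> incident E v \<Longrightarrow> 0 < i e \<and> i e < 1"
    "p \<notin> stone_cech (one_complex V E) closure_of (sc_embed (one_complex V E) ` star E v i)"
    "q \<notin> stone_cech (one_complex V E) closure_of (sc_embed (one_complex V E) ` star E v i)"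
proof -
  let ?K = "one_complex V E" and ?B = "stone_cech (one_complex V E)"
  have vK: "Vertex v \<in> topspace ?K" using v by (simp add: topspace_one_complex[OF G] complex_points_def)
  have sep: "\<exists>U W. openin ?B U \<and> openin ?B W \<and> sc_embed ?K (Vertex v) \<in> U \<and> r \<in> W \<and> disjnt U W"
    if "r \<in> topspace (stone_cech_remainder ?K)" for r
  proof -
    have "r \<in> topspace ?B" "r \<noteq> sc_embed ?K (Vertex v)"
      using that vK by (auto simp: topspace_stone_cech_remainder)
    then show ?thesis
      using compact_Hausdorff_stone_cech(2)[of ?K] sc_embed_in_stone_cech[OF vK]
      unfolding Hausdorff_space_def by metis
  qed
  obtain U W where U: "openin ?B U" "openin ?B W" "sc_embed ?K (Vertex v) \<in> U" "p \<in> W" "disjnt U W"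
    using sep[OF p] by blast
  obtain U' W' where U': "openin ?B U'" "openin ?B W'" "sc_embed ?K (Vertex v) \<in> U'" "q \<in> W'" "disjnt U' W'"
    using sep[OF q] by blast
  let ?N = "{w \<in> topspace ?K. sc_embed ?K w \<in> U \<inter> U'}"
  have "openin ?K ?N"
    using U(1) U'(1) by (intro openin_continuous_map_preimage[OF continuous_map_sc_embed]) (simp add: openin_Int)
  moreover have "Vertex v \<in> ?N" using vK U(3) U'(3) by simp
  ultimately obtain i where i: "\<forall>e\<in>incident E v. 0 < i e \<and> i e < 1"
      "(\<Union>e\<in>incident E v. half_open_segment v e (i e)) \<subseteq> ?N"
    unfolding openin_one_complex by (elim conjE) (drule spec, drule mp, assumption, elim exE conjE, blast)
  have sub: "sc_embed ?K ` star E v i \<subseteq> U \<inter> U'" using i(2) by (auto simp: star_def)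
  show ?thesis
  proof
    show "\<And>e. e \<in> incident E v \<Longrightarrow> 0 < i e \<and> i e < 1" using i(1) by blast
    show "p \<notin> ?B closure_of (sc_embed ?K ` star E v i)"
    proof
      assume "p \<in> ?B closure_of (sc_embed ?K ` star E v i)"
      then obtain y where "y \<in> sc_embed ?K ` star E v i" "y \<in> W"
        by (rule closure_of_meets_open[OF _ U(2,4)])
      then show False using sub U(5) by (auto simp: disjnt_iff)
    qed
    show "q \<notin> ?B closure_of (sc_embed ?K ` star E v i)"
    proof
      assume "q \<in> ?B closure_of (sc_embed ?K ` star E v i)"
      then obtain y where "y \<in> sc_embed ?K ` star E v i" "y \<in> W'"
        by (rule closure_of_meets_open[OF _ U'(2,4)])
      then show False using sub U'(5) by (auto simp: disjnt_iff)
    qed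
  qed
qed

text \<open>
  The points \<open>p\<close> and \<open>q\<close> of one fibre lie in a connected set \<open>Q\<close> that is the intersection of the
  closures of the open stars of all large \<open>\<A>\<close>, from which stars around the vertices of \<open>X\<close> are
  removed.  Without the removal the intersection could contain vertices \<open>v\<close> that send edges to every
  large set of components of \<open>G - X\<close> for every finite \<open>X\<close> with \<open>v \<in> X\<close>.  The removed stars are chosen with \<open>p\<close> and
  \<open>q\<close> off their closures, one star for each vertex independently of \<open>X\<close>, so that the family stays
  directed.
\<close>

lemma tangle_map_eq_imp_connected:
  assumes G: "simple_graph V E"
    and p: "p \<in> topspace (stone_cech_remainder (one_complex V E))"
    and q: "q \<in> topspace (stone_cech_remainder (one_complex V E))"
    and eq: "tangle_map V E p = tangle_map V E q"
  shows "connected_component_of (stone_cech_remainder (one_complex V E)) p q"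
proof -
  let ?K = "one_complex V E" and ?B = "stone_cech (one_complex V E)" and ?D = "graph_components V E"
  define \<tau> where "\<tau> = tangle_map V E p"
  have \<tau>: "\<tau> \<in> topspace (tangle_space V E)"
    using continuous_map_tangle_map[OF G] p by (simp add: continuous_map_def Pi_iff \<tau>_def)
  have \<tau>X: "\<tau> X \<in> topspace (stone_cech (discrete_topology (?D X)))" if "finite X" "X \<subseteq> V" for X
    using \<tau> that by (auto simp: in_tangle_space_iff PiE_iff component_space_def)
  have all_large: "large_set (?D X) (\<tau> X) (?D X)" if "finite X" "X \<subseteq> V" for X
    by (rule large_set_carrier[OF \<tau>X[OF that]])
  let ?avoids = "\<lambda>v i. (\<forall>e\<in>incident E v. 0 < i e \<and> i e < 1) \<and>
      p \<notin> ?B closure_of (sc_embed ?K ` star E v i) \<and> q \<notin> ?B closure_of (sc_embed ?K ` star E v i)"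
  have "\<forall>v\<in>V. \<exists>i. ?avoids v i"
  proof
    fix v assume "v \<in> V"
    then show "\<exists>i. ?avoids v i" by (rule star_avoiding_remainder_points[OF G _ p q]) blast
  qed
  then have "\<exists>i. \<forall>v\<in>V. ?avoids v (i v)" by (rule bchoice)
  then obtain i where i: "\<forall>v\<in>V. ?avoids v (i v)" by (elim exE)
  define T where "T = (\<lambda>X \<A>. open_star E (\<Union>\<A>) - (\<Union>x\<in>X. star E x (i x)))"
  let ?cl = "\<lambda>X \<A>. ?B closure_of (sc_embed ?K ` T X \<A>)"
  define \<F> where "\<F> = {?cl X \<A> |X \<A>. finite X \<and> X \<subseteq> V \<and> large_set (?D X) (\<tau> X) \<A>}"
  have \<F>I: "?cl X \<A> \<in> \<F>" if "finite X" "X \<subseteq> V" "large_set (?D X) (\<tau> X) \<A>" for X \<A>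
    unfolding \<F>_def using that by blast
  have \<F>E: "\<exists>X \<A>. F = ?cl X \<A> \<and> finite X \<and> X \<subseteq> V \<and> large_set (?D X) (\<tau> X) \<A>" if "F \<in> \<F>" for F
    using that unfolding \<F>_def by blast
  let ?Q = "\<Inter>\<F>"
  have Q_sub: "?Q \<subseteq> ?cl X \<A>" if "finite X" "X \<subseteq> V" "large_set (?D X) (\<tau> X) \<A>" for X \<A>
    using \<F>I[OF that] by (rule Inter_lower)
  have T_sub: "T X \<A> \<subseteq> complex_points V E" if "\<A> \<subseteq> ?D X" for X \<A>
  proof -
    have "\<Union>\<A> \<subseteq> V" using that graph_component_subset by blast
    then have "open_star E (\<Union>\<A>) \<subseteq> complex_points V E"
      using openin_subset[OF openin_open_star[of "\<Union>\<A>" V E]] by (simp add: topspace_one_complex[OF G])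
    then show ?thesis by (auto simp: T_def)
  qed

  \<comment> \<open>Since \<open>X\<close> is finite, the closure of the union of the removed stars is the union of their
    closures, so removing them does not lose \<open>p\<close> and \<open>q\<close>.\<close>
  have in_Q: "r \<in> ?Q"
    if r: "r \<in> topspace (stone_cech_remainder ?K)" and "tangle_map V E r = \<tau>"
      and off: "\<And>v. v \<in> V \<Longrightarrow> r \<notin> ?B closure_of (sc_embed ?K ` star E v (i v))" for r
  proof
    fix F assume "F \<in> \<F>"
    then obtain X \<A> where F: "F = ?cl X \<A>" and X: "finite X" "X \<subseteq> V" "large_set (?D X) (\<tau> X) \<A>"
      using \<F>E by blast
    have "\<A> \<subseteq> ?D X" using X(3) by (simp add: large_set_def)
    then have "r \<in> ?B closure_of (sc_embed ?K ` open_star E (\<Union>\<A>))"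
      using large_set_tangle_map_iff[OF G X(1,2) r] X(3) \<open>tangle_map V E r = \<tau>\<close> by simp
    also have "\<dots> \<subseteq> ?B closure_of (sc_embed ?K ` T X \<A> \<union> \<Union>((\<lambda>x. sc_embed ?K ` star E x (i x)) ` X))"
      by (rule closure_of_mono) (auto simp: T_def)
    also have "\<dots> = ?cl X \<A> \<union> (\<Union>x\<in>X. ?B closure_of (sc_embed ?K ` star E x (i x)))"
      using X(1) by (simp add: closure_of_Un closure_of_Union image_image)
    finally show "r \<in> F" using off X(2) unfolding F by blast
  qed
  have pQ: "p \<in> ?Q" by (rule in_Q[OF p]) (use i \<tau>_def in simp_all)
  have qQ: "q \<in> ?Q" by (rule in_Q[OF q]) (use i \<tau>_def eq in simp_all)

  \<comment> \<open>A vertex is excluded by the star removed around it, an inner point of an edge \<open>e\<close> by taking for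
    \<open>X\<close> the two ends of \<open>e\<close>.\<close>
  have "sc_embed ?K w \<notin> ?Q" if w: "w \<in> topspace ?K" for w
  proof (cases w)
    case (Vertex v)
    then have v: "v \<in> V" using w by (auto simp: topspace_one_complex[OF G] complex_points_def)
    have "sc_embed ?K (Vertex v) \<notin> ?cl {v} (?D {v})"
    proof (rule sc_embed_Vertex_notin_closure[OF G _ v])
      show "\<And>e. e \<in> incident E v \<Longrightarrow> 0 < i v e \<and> i v e < 1" using i v by blast
      show "T {v} (?D {v}) \<subseteq> complex_points V E" by (rule T_sub) simp
      show "T {v} (?D {v}) \<inter> star E v (i v) = {}" by (auto simp: T_def)
      show "Vertex v \<notin> T {v} (?D {v})" by (simp add: T_def Union_graph_components)
    qed
    then show ?thesis using Q_sub[OF _ _ all_large, of "{v}"] v Vertex by auto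
  next
    case (Inner e t)
    then have e: "e \<in> E" "0 < t" "t < 1" using w by (auto simp: topspace_one_complex[OF G] complex_points_def)
    have "sc_embed ?K (Inner e t) \<notin> ?cl e (?D e)"
    proof (rule sc_embed_Inner_notin_closure[OF G e])
      show "T e (?D e) \<subseteq> complex_points V E" by (rule T_sub) simp
      show "Inner e s \<notin> T e (?D e)" for s by (auto simp: T_def Union_graph_components)
    qed
    moreover have "finite e" "e \<subseteq> V"
      using G e(1) by (auto simp: simple_graph_def intro: card_ge_0_finite)
    ultimately show ?thesis using Q_sub[OF _ _ all_large, of e] Inner by auto
  qed
  moreover have "?Q \<subseteq> topspace ?B"
    using Q_sub[OF _ _ all_large, of "{}"] closure_of_subset_topspace by fastforce
  ultimately have Q_remainder: "?Q \<subseteq> topspace ?B - sc_embed ?K ` topspace ?K" by auto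

  have closed: "closedin ?B F" if "F \<in> \<F>" for F using \<F>E[OF that] by auto
  have "\<F> \<noteq> {}" using \<F>I[OF _ _ all_large, of "{}"] by auto
  have directed: "\<exists>A\<in>\<F>. A \<subseteq> F \<inter> H" if FH: "F \<in> \<F>" "H \<in> \<F>" for F H
  proof -
    obtain X \<A> where F: "F = ?cl X \<A>" and X: "finite X" "X \<subseteq> V" "large_set (?D X) (\<tau> X) \<A>"
      using \<F>E[OF FH(1)] by blast
    obtain Y \<B> where H: "H = ?cl Y \<B>" and Y: "finite Y" "Y \<subseteq> V" "large_set (?D Y) (\<tau> Y) \<B>"
      using \<F>E[OF FH(2)] by blast
    obtain \<C> where C: "large_set (?D (X \<union> Y)) (\<tau> (X \<union> Y)) \<C>" "\<Union>\<C> \<subseteq> \<Union>\<A> \<inter> \<Union>\<B>"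
      by (rule large_set_directed[OF \<tau> X Y])
    have "T (X \<union> Y) \<C> \<subseteq> T X \<A>" "T (X \<union> Y) \<C> \<subseteq> T Y \<B>"
      using open_star_mono[of "\<Union>\<C>" "\<Union>\<A>" E] open_star_mono[of "\<Union>\<C>" "\<Union>\<B>" E] C(2)
      unfolding T_def by blast+
    then have "?cl (X \<union> Y) \<C> \<subseteq> F" "?cl (X \<union> Y) \<C> \<subseteq> H"
      unfolding F H by (simp_all add: closure_of_mono image_mono)
    then show ?thesis using \<F>I[OF _ _ C(1)] X Y by blast
  qed

  have piece_connected: "connectedin ?B (sc_embed ?K ` T X {C})" if "C \<in> ?D X" for X C
    using connectedin_continuous_map_image[OF continuous_map_sc_embed
        connectedin_component_minus_stars[OF G that, of i]] by (simp add: T_def)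
  have T_Union: "T X \<A> = (\<Union>C\<in>\<A>. T X {C})" for X \<A>
    by (auto simp: T_def open_star_Union)
  \<comment> \<open>If all pieces of a large set lie in \<open>U\<close>, then \<open>Q\<close> lies in the closure of \<open>U\<close>.\<close>
  have miss: "?Q \<inter> W = {}"
    if X: "finite X" "X \<subseteq> V" "large_set (?D X) (\<tau> X) \<A>"
      and U: "\<And>C. C \<in> \<A> \<Longrightarrow> sc_embed ?K ` T X {C} \<subseteq> U" and "U \<inter> W = {}" "openin ?B W" for X \<A> U W
  proof (rule ccontr)
    assume "?Q \<inter> W \<noteq> {}"
    then obtain r where "r \<in> ?Q" "r \<in> W" by blast
    then have "r \<in> ?cl X \<A>" using Q_sub[OF X] by blast
    then obtain y where "y \<in> sc_embed ?K ` T X \<A>" "y \<in> W"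
      using \<open>openin ?B W\<close> \<open>r \<in> W\<close> by (rule closure_of_meets_open)
    moreover have "sc_embed ?K ` T X \<A> \<subseteq> U" using U unfolding T_Union[of X \<A>] by auto
    ultimately show False using \<open>U \<inter> W = {}\<close> by blast
  qed
  have "connectedin ?B ?Q"
    unfolding connectedin_closedin
  proof (intro conjI notI)
    show "?Q \<subseteq> topspace ?B" by fact
    assume "\<exists>E1 E2. closedin ?B E1 \<and> closedin ?B E2 \<and> ?Q \<subseteq> E1 \<union> E2 \<and> E1 \<inter> E2 \<inter> ?Q = {} \<and>
      E1 \<inter> ?Q \<noteq> {} \<and> E2 \<inter> ?Q \<noteq> {}"
    then obtain E1 E2 where E: "closedin ?B E1" "closedin ?B E2" "?Q \<subseteq> E1 \<union> E2" "E1 \<inter> E2 \<inter> ?Q = {}"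
      "E1 \<inter> ?Q \<noteq> {}" "E2 \<inter> ?Q \<noteq> {}" by (elim exE conjE)
    have Q: "closedin ?B ?Q" using \<open>\<F> \<noteq> {}\<close> closed by (rule closedin_Inter)
    have "normal_space ?B"
      using compact_Hausdorff_stone_cech compact_Hausdorff_or_regular_imp_normal_space by blast
    moreover have "closedin ?B (E1 \<inter> ?Q)" "closedin ?B (E2 \<inter> ?Q)"
      using closedin_Int[OF E(1) Q] closedin_Int[OF E(2) Q] by simp_all
    moreover have "disjnt (E1 \<inter> ?Q) (E2 \<inter> ?Q)" using E(4) unfolding disjnt_def by blast
    ultimately obtain U W where UW: "openin ?B U" "openin ?B W" "E1 \<inter> ?Q \<subseteq> U" "E2 \<inter> ?Q \<subseteq> W" "disjnt U W"
      unfolding normal_space_def by meson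
    \<comment> \<open>Compactness moves a separation of \<open>Q\<close> to one member of the family.  There each piece, being
      connected, is on one side, and the pieces on one of the sides form a large set.\<close>
    have "\<exists>F\<in>\<F>. F \<subseteq> U \<union> W"
    proof (rule compact_directed_Inter_subset[OF compact_Hausdorff_stone_cech(1) closed \<open>\<F> \<noteq> {}\<close> directed])
      show "openin ?B (U \<union> W)" using UW(1,2) by (rule openin_Un)
      show "?Q \<subseteq> U \<union> W" using E(3) UW(3,4) by blast
    qed
    then obtain F where "F \<in> \<F>" and F_UW: "F \<subseteq> U \<union> W" by (elim bexE)
    then obtain X \<A> where F: "F = ?cl X \<A>" and X: "finite X" "X \<subseteq> V" and large: "large_set (?D X) (\<tau> X) \<A>"
      using \<F>E by blast
    have A: "\<A> \<subseteq> ?D X" using large by (simp add: large_set_def)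
    have "sc_embed ?K ` T X \<A> \<subseteq> topspace ?B"
      using T_sub[OF A] sc_embed_in_stone_cech[of _ ?K] by (auto simp: topspace_one_complex[OF G])
    then have in_UW: "sc_embed ?K ` T X \<A> \<subseteq> U \<union> W"
      using F_UW closure_of_subset unfolding F by blast
    have split: "sc_embed ?K ` T X {C} \<subseteq> U \<or> sc_embed ?K ` T X {C} \<subseteq> W" if "C \<in> \<A>" for C
    proof -
      let ?S = "sc_embed ?K ` T X {C}"
      have S: "?S \<subseteq> U \<union> W" using in_UW that unfolding T_Union[of X \<A>] by blast
      have "\<not> (U \<inter> ?S \<noteq> {} \<and> W \<inter> ?S \<noteq> {})"
      proof
        assume "U \<inter> ?S \<noteq> {} \<and> W \<inter> ?S \<noteq> {}"
        moreover have "U \<inter> W \<inter> ?S = {}" using UW(5) unfolding disjnt_def by blast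
        moreover have "connectedin ?B ?S" using piece_connected that A by blast
        ultimately show False using S UW(1,2) unfolding connectedin by blast
      qed
      then show ?thesis using S by blast
    qed
    let ?\<A>1 = "{C \<in> \<A>. sc_embed ?K ` T X {C} \<subseteq> U}" and ?\<A>2 = "{C \<in> \<A>. sc_embed ?K ` T X {C} \<subseteq> W}"
    have "\<A> = ?\<A>1 \<union> ?\<A>2" using split by blast
    then have "large_set (?D X) (\<tau> X) (?\<A>1 \<union> ?\<A>2)" using large by simp
    then have "large_set (?D X) (\<tau> X) ?\<A>1 \<or> large_set (?D X) (\<tau> X) ?\<A>2"
      by (rule large_set_Un[OF \<tau>X[OF X]])
    then have "?Q \<inter> W = {} \<or> ?Q \<inter> U = {}"
    proof
      assume "large_set (?D X) (\<tau> X) ?\<A>1"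
      then have "?Q \<inter> W = {}"
        by (rule miss[OF X, where U = U]) (use UW in \<open>auto simp: disjnt_def\<close>)
      then show ?thesis by simp
    next
      assume "large_set (?D X) (\<tau> X) ?\<A>2"
      then have "?Q \<inter> U = {}"
        by (rule miss[OF X, where U = W]) (use UW in \<open>auto simp: disjnt_def\<close>)
      then show ?thesis by simp
    qed
    then show False using E(5,6) UW(3,4) by blast
  qed
  then have "connectedin (stone_cech_remainder ?K) ?Q"
    using Q_remainder by (simp add: stone_cech_remainder_def connectedin_subtopology)
  then show ?thesis
    unfolding connected_component_of_def using pQ qQ by (intro exI[of _ ?Q]) simp
qed

theorem theorem5p23:
  fixes V :: "'a set" and E :: "'a set set"
  assumes "simple_graph V E" and "connected_graph V E" and "infinite V"
  shows "tangle_space V E homeomorphic_space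
    quotient_topology (stone_cech_remainder (one_complex V E))
      (same_component (stone_cech_remainder (one_complex V E)))"
proof (rule quotient_map_imp_homeomorphic_quotient_topology[OF quotient_map_tangle_map[OF assms(1)]])
  let ?R = "stone_cech_remainder (one_complex V E)"
  fix p q assume p: "p \<in> topspace ?R" and q: "q \<in> topspace ?R"
  have "tangle_map V E p = tangle_map V E q \<longleftrightarrow> connected_component_of ?R p q"
    using tangle_map_eq_imp_connected[OF assms(1) p q] connected_imp_tangle_map_eq[OF assms(1)] by blast
  also have "\<dots> \<longleftrightarrow> connected_component_of ?R p = connected_component_of ?R q"
    using p q connected_component_of_equiv[of ?R p q] by simp
  also have "\<dots> \<longleftrightarrow> same_component ?R `` {p} = same_component ?R `` {q}"
    by (simp add: same_component_def Image_def set_eq_iff fun_eq_iff)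
  finally show "tangle_map V E p = tangle_map V E q \<longleftrightarrow>
      same_component ?R `` {p} = same_component ?R `` {q}" .
qed

end
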